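(* Let $\mathcal{H}_T=\mathbb{C}^2$, let $\mathcal{H}_A,\mathcal{H}_B$ be finite-dimensional Hilbert spaces of dimension at least $2$, and let $\rho_{TAB}$ be any density operator on $\mathcal{H}_T\otimes\mathcal{H}_A\otimes\mathcal{H}_B$. Then all four C-PID elements of $\rho_{TAB}$ are non-negative: $C_{\mathrm{unq}A}\ge 0$, $C_{\mathrm{unq}B}\ge 0$, $C_{\mathrm{red}}\ge 0$ and $C_{\mathrm{syn}}\ge 0$.
   Context: $H(\cdot)$ is the von Neumann entropy with base-2 logarithm; reduced states are denoted $\rho_T,\rho_{TA},\rho_{TB}$, etc. Fix an orthonormal eigenbasis $\{|0\rangle,|1\rangle\}$ of $\rho_T$, and let $\sigma_x,\sigma_y,\sigma_z$ be the Pauli matrices on $\mathcal{H}_T$ with respect to this basis; for $\phi\in[0,2\pi)$ put $\sigma_x^{\phi}=\cos\phi\,\sigma_x+\sin\phi\,\sigma_y$ (this is $\sigma_x$ in the basis $\{|0\rangle,e^{i\phi}|1\rangle\}$). For $S\in\{A,B,AB\}$ the superdense (two-bit) capacity is $C_S=H(\Phi_C(\rho_{TS}))-H(\rho_{TS})$, where $\Phi_C(\rho_{TS})=\frac14\sum_{\sigma\in\{\mathbb{1},\sigma_x,\sigma_y,\sigma_z\}}(\sigma\otimes\mathbb{1}_S)\rho_{TS}(\sigma\otimes\mathbb{1}_S)=\frac12\mathbb{1}_T\otimes\rho_S$; thus $C_S=1+H(\rho_S)-H(\rho_{TS})$. For a Hermitian unitary $\sigma$ on $\mathcal{H}_T$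 let $\Phi_\sigma(\rho_{TS})=\frac12\left(\rho_{TS}+(\sigma\otimes\mathbb{1}_S)\rho_{TS}(\sigma\otimes\mathbb{1}_S)\right)$. For $S\in\{A,B\}$ the parallel and transverse one-bit capacities are $\mathcal{C}_S^{\parallel}=H(\Phi_{\sigma_z}(\rho_{TS}))-H(\rho_{TS})$ and $\mathcal{C}_S^{\perp}=\frac1{2\pi}\int_0^{2\pi}\left[H(\Phi_{\sigma_x^{\phi}}(\rho_{TS}))-H(\rho_{TS})\right]d\phi$. One-bit unique capacities: $\Gamma_A=\max(\mathcal{C}_A^{\parallel}-\mathcal{C}_B^{\parallel},0)+\max(\mathcal{C}_A^{\perp}-\mathcal{C}_B^{\perp},0)$, and $\Gamma_B$ is the same with $A,B$ exchanged. Let $\Delta_A=(C_A-C_B)-(\Gamma_A-\Gamma_B)$, $\Delta_B=-\Delta_A$, $\gamma_A=\Gamma_A+\min(\Delta_A,0)$, $\gamma_B=\Gamma_B+\min(\Delta_B,0)$. The C-PID elements are $C_{\mathrm{unq}A}=\max(\gamma_A,0)-\min(\gamma_B,0)$, $C_{\mathrm{unq}B}=\max(\gamma_B,0)-\min(\gamma_A,0)$, $C_{\mathrm{red}}=\frac12(C_A+C_B-|\gamma_A|-|\gamma_B|)$, $C_{\mathrm{syn}}=C_{AB}-\frac12(C_A+C_B+|\gamma_A|+|\gamma_B|)$. *)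

theory Defs
  imports "HOL-Analysis.Analysis"
begin

text \<open>
  Operators on an \<open>n\<close>-dimensional Hilbert space are square complex matrices indexed by a finite
  type with \<open>n\<close> elements; a tensor product of spaces is indexed by the product of the index types.
  The qubit \<open>T\<close> has index type \<open>2\<close>, so a state of \<open>TAB\<close> is indexed by \<open>2 \<times> 'a \<times> 'b\<close>, which is
  read both as \<open>T\<otimes>A\<otimes>B\<close> and as \<open>T\<otimes>(A\<otimes>B)\<close>.
\<close>

definition cinner :: "complex^'n \<Rightarrow> complex^'n \<Rightarrow> complex" where
  "cinner u v = (\<Sum>i\<in>UNIV. cnj (u $ i) * v $ i)"

definition adjoint_mat :: "complex^'n^'n \<Rightarrow> complex^'n^'n" where
  "adjoint_mat A = (\<chi> i j. cnj (A $ j $ i))"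

definition hermitian :: "complex^'n^'n \<Rightarrow> bool" where
  "hermitian A \<longleftrightarrow> adjoint_mat A = A"

definition density_operator :: "complex^'n^'n \<Rightarrow> bool" where
  "density_operator R \<longleftrightarrow>
     hermitian R \<and> (\<forall>v. Re (cinner v (R *v v)) \<ge> 0) \<and> trace R = 1"

definition tensor :: "complex^'m^'m \<Rightarrow> complex^'n^'n \<Rightarrow> complex^('m \<times> 'n)^('m \<times> 'n)" where
  "tensor A B = (\<chi> i j. A $ fst i $ fst j * B $ snd i $ snd j)"

definition outer :: "complex^'n \<Rightarrow> complex^'n \<Rightarrow> complex^'n^'n" where
  "outer u v = (\<chi> i j. u $ i * cnj (v $ j))"

text \<open>
  Functional calculus: for hermitian \<open>A\<close> (the only case used), \<open>herm_fun f A\<close> is the unique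
  operator acting as the scalar \<open>f l\<close> on the eigenspace of each eigenvalue \<open>l\<close> of \<open>A\<close>.
\<close>

definition herm_fun :: "(real \<Rightarrow> real) \<Rightarrow> complex^'n^'n \<Rightarrow> complex^'n^'n" where
  "herm_fun f A = (THE B. \<forall>l v. A *v v = complex_of_real l *s v \<longrightarrow>
                                 B *v v = complex_of_real (f l) *s v)"

lemma herm_fun_unitary_diag:
  fixes U :: "complex^'n^'n" and d :: "'n \<Rightarrow> real"
  defines "D \<equiv> \<lambda>g. (\<chi> i j. if i = j then complex_of_real (g (d i)) else 0) :: complex^'n^'n"
  assumes U: "adjoint_mat U ** U = mat 1" "U ** adjoint_mat U = mat 1"
    and A: "A = U ** D (\<lambda>x. x) ** adjoint_mat U"
  shows "herm_fun f A = U ** D f ** adjoint_mat U"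
  unfolding herm_fun_def
proof (rule the_equality)
  have D: "(D g *v w) $ i = complex_of_real (g (d i)) * w $ i" for g w i
    by (simp add: D_def matrix_vector_mult_def if_distrib[of "\<lambda>x. x * _"] cong: if_cong)
  show "\<forall>l v. A *v v = complex_of_real l *s v \<longrightarrow>
              U ** D f ** adjoint_mat U *v v = complex_of_real (f l) *s v"
  proof (intro allI impI)
    fix l v assume v: "A *v v = complex_of_real l *s v"
    define w where "w = adjoint_mat U *v v"
    have vw: "v = U *v w" by (simp add: w_def matrix_vector_mul_assoc U)
    have "adjoint_mat U *v (A *v v) = D (\<lambda>x. x) *v w"
      by (simp add: A w_def matrix_vector_mul_assoc matrix_mul_assoc U)
    hence "D (\<lambda>x. x) *v w = complex_of_real l *s w"
      by (simp add: v w_def vector_scalar_commute)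
    hence "complex_of_real (d i) * w $ i = complex_of_real l * w $ i" for i
      by (metis D vector_smult_component)
    hence "D f *v w = complex_of_real (f l) *s w"
      by (simp add: vec_eq_iff D) (metis mult_cancel_right of_real_eq_iff)
    thus "U ** D f ** adjoint_mat U *v v = complex_of_real (f l) *s v"
      by (metis matrix_vector_mul_assoc vector_scalar_commute vw w_def)
  qed
  fix B assume B: "\<forall>l v. A *v v = complex_of_real l *s v \<longrightarrow> B *v v = complex_of_real (f l) *s v"
  have ax: "D g *v axis i 1 = complex_of_real (g (d i)) *s axis i 1" for g i
    by (simp add: vec_eq_iff D axis_def)
  have "(B ** U) *v axis i 1 = (U ** D f) *v axis i 1" for i
  proof -
    have "A *v (U *v axis i 1) = U *v (D (\<lambda>x. x) *v axis i 1)"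
      by (metis A U(1) matrix_mul_assoc matrix_mul_rid matrix_vector_mul_assoc)
    hence "A *v (U *v axis i 1) = complex_of_real (d i) *s (U *v axis i 1)"
      by (simp add: ax vector_scalar_commute)
    hence "B *v (U *v axis i 1) = complex_of_real (f (d i)) *s (U *v axis i 1)"
      using B by blast
    thus ?thesis
      by (metis ax matrix_vector_mul_assoc vector_scalar_commute)
  qed
  hence "B ** U = U ** D f"
    by (simp add: vec_eq_iff matrix_vector_mult_def axis_def if_distrib[of "\<lambda>x. _ * x"] cong: if_cong)
  thus "B = U ** D f ** adjoint_mat U"
    by (metis U(2) matrix_mul_assoc matrix_mul_rid)
qed

text \<open>
  \<open>H(R) = - tr (R log R)\<close> with logarithm to base 2. Since \<open>log 2 0 = 0\<close> in HOL, the eigenvalue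
  \<open>0\<close> contributes \<open>0\<close>, which is the usual convention. The trace is real; \<open>Re\<close> only changes the type.
\<close>

definition vn_entropy :: "complex^'n^'n \<Rightarrow> real" where
  "vn_entropy R = - Re (trace (R ** herm_fun (log 2) R))"

definition reduce_T :: "complex^(2 \<times> 's::finite)^(2 \<times> 's) \<Rightarrow> complex^2^2" where
  "reduce_T R = (\<chi> i j. \<Sum>s\<in>UNIV. R $ (i, s) $ (j, s))"

definition reduce_TA ::
    "complex^(2 \<times> 'a::finite \<times> 'b::finite)^(2 \<times> 'a \<times> 'b) \<Rightarrow> complex^(2 \<times> 'a)^(2 \<times> 'a)" where
  "reduce_TA R = (\<chi> i j. \<Sum>b\<in>UNIV. R $ (fst i, snd i, b) $ (fst j, snd j, b))"

definition reduce_TB ::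
    "complex^(2 \<times> 'a::finite \<times> 'b::finite)^(2 \<times> 'a \<times> 'b) \<Rightarrow> complex^(2 \<times> 'b)^(2 \<times> 'b)" where
  "reduce_TB R = (\<chi> i j. \<Sum>a\<in>UNIV. R $ (fst i, a, snd i) $ (fst j, a, snd j))"

text \<open>Two orthonormal vectors of \<open>\<complex>\<^sup>2\<close> automatically form a basis.\<close>

definition orthonormal_eigenbasis :: "complex^2^2 \<Rightarrow> complex^2 \<Rightarrow> complex^2 \<Rightarrow> bool" where
  "orthonormal_eigenbasis M e0 e1 \<longleftrightarrow>
     cinner e0 e0 = 1 \<and> cinner e1 e1 = 1 \<and> cinner e0 e1 = 0 \<and>
     (\<exists>c. M *v e0 = c *s e0) \<and> (\<exists>c. M *v e1 = c *s e1)"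

text \<open>Pauli matrices with respect to the basis \<open>|0\<rangle> = e0\<close>, \<open>|1\<rangle> = e1\<close>.\<close>

definition pauli_x :: "complex^2 \<Rightarrow> complex^2 \<Rightarrow> complex^2^2" where
  "pauli_x e0 e1 = outer e0 e1 + outer e1 e0"

definition pauli_y :: "complex^2 \<Rightarrow> complex^2 \<Rightarrow> complex^2^2" where
  "pauli_y e0 e1 = outer (- \<i> *s e0) e1 + outer (\<i> *s e1) e0"

definition pauli_z :: "complex^2 \<Rightarrow> complex^2 \<Rightarrow> complex^2^2" where
  "pauli_z e0 e1 = outer e0 e0 - outer e1 e1"

definition pauli_x_rot :: "real \<Rightarrow> complex^2 \<Rightarrow> complex^2 \<Rightarrow> complex^2^2" where
  "pauli_x_rot \<phi> e0 e1 = cos \<phi> *\<^sub>R pauli_x e0 e1 + sin \<phi> *\<^sub>R pauli_y e0 e1"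

definition conj_T ::
    "complex^2^2 \<Rightarrow> complex^(2 \<times> 's::finite)^(2 \<times> 's) \<Rightarrow> complex^(2 \<times> 's)^(2 \<times> 's)" where
  "conj_T \<sigma> R = tensor \<sigma> (mat 1) ** R ** tensor \<sigma> (mat 1)"

definition Phi_C ::
    "complex^2 \<Rightarrow> complex^2 \<Rightarrow> complex^(2 \<times> 's::finite)^(2 \<times> 's) \<Rightarrow> complex^(2 \<times> 's)^(2 \<times> 's)" where
  "Phi_C e0 e1 R = (1/4) *\<^sub>R
     (conj_T (mat 1) R + conj_T (pauli_x e0 e1) R + conj_T (pauli_y e0 e1) R
      + conj_T (pauli_z e0 e1) R)"

definition Phi_one ::
    "complex^2^2 \<Rightarrow> complex^(2 \<times> 's::finite)^(2 \<times> 's) \<Rightarrow> complex^(2 \<times> 's)^(2 \<times> 's)" where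
  "Phi_one \<sigma> R = (1/2) *\<^sub>R (R + conj_T \<sigma> R)"

definition cap :: "complex^2 \<Rightarrow> complex^2 \<Rightarrow> complex^(2 \<times> 's::finite)^(2 \<times> 's) \<Rightarrow> real" where
  "cap e0 e1 R = vn_entropy (Phi_C e0 e1 R) - vn_entropy R"

definition cap_par :: "complex^2 \<Rightarrow> complex^2 \<Rightarrow> complex^(2 \<times> 's::finite)^(2 \<times> 's) \<Rightarrow> real" where
  "cap_par e0 e1 R = vn_entropy (Phi_one (pauli_z e0 e1) R) - vn_entropy R"

definition cap_perp :: "complex^2 \<Rightarrow> complex^2 \<Rightarrow> complex^(2 \<times> 's::finite)^(2 \<times> 's) \<Rightarrow> real" where
  "cap_perp e0 e1 R = 1 / (2 * pi) *
     integral {0..2 * pi} (\<lambda>\<phi>. vn_entropy (Phi_one (pauli_x_rot \<phi> e0 e1) R) - vn_entropy R)"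

text \<open>
  One-bit capacity unique to the first of two systems, given its joint state with \<open>T\<close> and that
  of the second: \<open>\<Gamma>\<^sub>A\<close> and \<open>\<Gamma>\<^sub>B\<close> below are obtained by exchanging the arguments.
\<close>

definition unique_one_bit ::
    "complex^2 \<Rightarrow> complex^2 \<Rightarrow> complex^(2 \<times> 'r::finite)^(2 \<times> 'r)
      \<Rightarrow> complex^(2 \<times> 's::finite)^(2 \<times> 's) \<Rightarrow> real" where
  "unique_one_bit e0 e1 R S =
     max (cap_par e0 e1 R - cap_par e0 e1 S) 0 + max (cap_perp e0 e1 R - cap_perp e0 e1 S) 0"

context
  fixes e0 e1 :: "complex^2"
    and R :: "complex^(2 \<times> 'a::finite \<times> 'b::finite)^(2 \<times> 'a \<times> 'b)"
begin

definition C_A :: real where "C_A = cap e0 e1 (reduce_TA R)"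
definition C_B :: real where "C_B = cap e0 e1 (reduce_TB R)"
definition C_AB :: real where "C_AB = cap e0 e1 R"

definition Gamma_A :: real where "Gamma_A = unique_one_bit e0 e1 (reduce_TA R) (reduce_TB R)"
definition Gamma_B :: real where "Gamma_B = unique_one_bit e0 e1 (reduce_TB R) (reduce_TA R)"

definition Delta_A :: real where "Delta_A = (C_A - C_B) - (Gamma_A - Gamma_B)"
definition Delta_B :: real where "Delta_B = - Delta_A"

definition gamma_A :: real where "gamma_A = Gamma_A + min Delta_A 0"
definition gamma_B :: real where "gamma_B = Gamma_B + min Delta_B 0"

definition C_unqA :: real where "C_unqA = max gamma_A 0 - min gamma_B 0"
definition C_unqB :: real where "C_unqB = max gamma_B 0 - min gamma_A 0"
definition C_red :: real where "C_red = 1/2 * (C_A + C_B - \<bar>gamma_A\<bar> - \<bar>gamma_B\<bar>)"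
definition C_syn :: real where "C_syn = C_AB - 1/2 * (C_A + C_B + \<bar>gamma_A\<bar> + \<bar>gamma_B\<bar>)"

end

end

theory Submission
  imports Defs
begin

text \<open>
  The four-Pauli channel is \<open>\<Phi>\<^sub>x \<circ> \<Phi>\<^sub>z\<close>, so \<open>C\<^sub>S = C\<^sub>S\<^sup>\<parallel> + y\<^sub>S\<close>, where both summands have
  the form \<open>H(\<Phi>\<^sub>\<sigma>(\<rho>)) - H(\<rho>)\<close>. Both are nonnegative and can only decrease when \<open>A\<close> or \<open>B\<close> is
  traced out. From these facts the claim is linear arithmetic, whatever the transverse capacities are:
  \<open>\<bar>\<gamma>\<^sub>A\<bar> + \<bar>\<gamma>\<^sub>B\<bar> = max \<bar>\<gamma>\<^sub>A + \<gamma>\<^sub>B\<bar> \<bar>C\<^sub>A - C\<^sub>B\<bar>\<close>, and the mixed sums \<open>C\<^sub>A\<^sup>\<parallel> + y\<^sub>B\<close> and \<open>C\<^sub>B\<^sup>\<parallel> + y\<^sub>A\<close>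
  are bounded by \<open>C\<^sub>A\<^sub>B\<close>.

  With \<open>\<rho>' = \<sigma>\<rho>\<sigma>\<close> and \<open>m = (\<rho> + \<rho>')/2\<close>, the gap is \<open>H(m) - (H(\<rho>) + H(\<rho>'))/2\<close>, a mean of the two
  relative entropies with respect to \<open>m\<close>. Taylor's formula for \<open>p ln p\<close> writes a relative entropy as
  \<open>\<integral>\<^sub>0\<^sup>1 (1 - u) F\<^sub>u(\<rho>, m) du\<close> with
  \<open>F\<^sub>u(\<rho>, m) = \<Sum>\<^sub>i\<^sub>j \<bar>\<langle>i|j\<rangle>\<bar>\<^sup>2 (p\<^sub>i - q\<^sub>j)\<^sup>2 / (u p\<^sub>i + (1 - u) q\<^sub>j)\<close> in eigenbases of \<open>\<rho>\<close> and \<open>m\<close>. Completing the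
  square, \<open>F\<^sub>u\<close> is the maximum over \<open>Y\<close> of
  \<open>2 Re tr(Y\<^sup>*(\<rho> - m)) - u tr(Y\<^sup>*\<rho>Y) - (1 - u) tr(Y m Y\<^sup>*)\<close>.
  For \<open>Y \<otimes> 1\<close> this expression depends only on the reduced states, so \<open>F\<^sub>u\<close> decreases under partial
  trace: no operator convexity is needed.
\<close>

subsection \<open>Diagonalization of hermitian matrices\<close>

lemma cinner_add_right: "cinner u (v + w) = cinner u v + cinner u w"
  by (simp add: cinner_def distrib_left sum.distrib)

lemma cinner_diff_right: "cinner u (v - w) = cinner u v - cinner u w"
  by (simp add: cinner_def right_diff_distrib sum_subtractf)

lemma cinner_scale_right: "cinner u (c *s v) = c * cinner u v"
  by (simp add: cinner_def sum_distrib_left mult_ac)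

lemma cinner_sum_right: "cinner u (\<Sum>i\<in>I. f i) = (\<Sum>i\<in>I. cinner u (f i))"
  unfolding cinner_def sum_component sum_distrib_left by (rule sum.swap)

lemma cnj_cinner: "cnj (cinner u v) = cinner v u"
  by (simp add: cinner_def mult.commute)

lemma cinner_add_left: "cinner (v + w) u = cinner v u + cinner w u"
  by (simp add: cinner_def distrib_right sum.distrib)

lemma cinner_scale_left: "cinner (c *s v) u = cnj c * cinner v u"
  by (simp add: cinner_def sum_distrib_left mult_ac)

lemma cinner_self: "cinner v v = complex_of_real ((norm v)\<^sup>2)"
proof -
  have "(norm v)\<^sup>2 = (\<Sum>i\<in>UNIV. (norm (v $ i))\<^sup>2)"
    by (simp add: norm_vec_def L2_set_def sum_nonneg)
  thus ?thesis
    by (simp add: cinner_def mult.commute[of "cnj _"] complex_norm_square[symmetric])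
qed

lemma cinner_matrix: "cinner u (A *v v) = cinner (adjoint_mat A *v u) v"
  by (simp add: cinner_def adjoint_mat_def matrix_vector_mult_def sum_distrib_left
      sum_distrib_right mult_ac) (rule sum.swap)

lemma continuous_on_cinner [continuous_intros]:
  "continuous_on S f \<Longrightarrow> continuous_on S g \<Longrightarrow> continuous_on S (\<lambda>x. cinner (f x) (g x))"
  unfolding cinner_def by (intro continuous_intros)

lemma continuous_on_matrix_vector [continuous_intros]:
  fixes A :: "complex^'n^'m"
  shows "continuous_on S f \<Longrightarrow> continuous_on S (\<lambda>x. A *v f x)"
  unfolding matrix_vector_mult_def by (intro continuous_intros)

lemma adjoint_mult: "adjoint_mat (A ** B) = adjoint_mat B ** adjoint_mat A"
  by (simp add: adjoint_mat_def matrix_matrix_mult_def vec_eq_iff mult.commute)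

lemma adjoint_adjoint [simp]: "adjoint_mat (adjoint_mat A) = A"
  by (simp add: adjoint_mat_def vec_eq_iff)

text \<open>On the compact unit sphere of \<open>W\<close> the Rayleigh quotient attains its maximum
  at some \<open>x\<close>; unless the residual \<open>A *v x - l *s x\<close> vanishes, moving
  along it would raise the quotient to first order. Working in an invariant \<open>W\<close> allows
  eigenvectors already found to be split off.\<close>

lemma rayleigh_eigenvector:
  fixes A :: "complex^'n^'n"
  assumes A: "hermitian A"
    and "closed W" and add: "\<And>x y. x \<in> W \<Longrightarrow> y \<in> W \<Longrightarrow> x + y \<in> W"
    and scale: "\<And>c x. x \<in> W \<Longrightarrow> c *s x \<in> W"
    and inv: "\<And>x. x \<in> W \<Longrightarrow> A *v x \<in> W"
    and z: "z \<in> W" "z \<noteq> 0"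
  shows "\<exists>x\<in>W. \<exists>l. cinner x x = 1 \<and> A *v x = complex_of_real l *s x"
proof -
  define f where "f x = Re (cinner x (A *v x))" for x
  define K where "K = W \<inter> sphere 0 1"
  have f_scale: "f (complex_of_real c *s x) = c\<^sup>2 * f x" for c x
    by (simp add: f_def vector_scalar_commute cinner_scale_left cinner_scale_right power2_eq_square
        mult_ac)
  have norm_scale: "norm (complex_of_real c *s x) = \<bar>c\<bar> * norm x" for c and x :: "complex^'n"
    by (simp add: norm_vec_def norm_mult L2_set_right_distrib)
  have normalize: "complex_of_real (1 / norm y) *s y \<in> K" if "y \<in> W" "y \<noteq> 0" for y
    using that scale by (simp add: K_def norm_scale del: of_real_divide)
  have "compact K" unfolding K_def
    by (metis Int_commute \<open>closed W\<close> compact_Int_closed compact_sphere)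
  moreover have "K \<noteq> {}" using normalize[OF z] by blast
  moreover have "continuous_on K f"
    unfolding f_def by (intro continuous_intros)
  ultimately obtain x where x: "x \<in> K" and max: "\<And>y. y \<in> K \<Longrightarrow> f y \<le> f x"
    using continuous_attains_sup by metis
  define l where "l = f x"
  have xW: "x \<in> W" and nx: "norm x = 1" using x by (auto simp: K_def)
  have bound: "f y \<le> l * (norm y)\<^sup>2" if "y \<in> W" for y
  proof (cases "y = 0")
    case False
    have "(1 / norm y)\<^sup>2 * f y \<le> l"
      using max[OF normalize[OF that False]] unfolding f_scale l_def .
    thus ?thesis using False by (simp add: field_simps)
  qed (simp add: f_def cinner_def)
  define r where "r = A *v x - complex_of_real l *s x"
  have rW: "r \<in> W"
    using add[OF inv[OF xW] scale[OF xW, of "- complex_of_real l"]]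
    by (simp add: r_def vec_eq_iff)
  define k where "k = l * (norm r)\<^sup>2 - f r"
  \<comment> \<open>Insert \<open>x + t r\<close> into \<open>bound\<close>: the first-order terms
    differ by \<open>2 * t * (norm r)\<^sup>2\<close>, the second-order terms by
    \<open>t\<^sup>2 * k\<close>.\<close>
  have ineq: "2 * (norm r)\<^sup>2 \<le> t * k" if t: "t > 0" for t :: real
  proof -
    define y where "y = x + complex_of_real t *s r"
    have "y \<in> W" unfolding y_def using add xW scale rW by blast
    have "adjoint_mat A = A" using A by (simp add: hermitian_def)
    hence c1: "Re (cinner x (A *v r)) = Re (cinner r (A *v x))"
      by (metis cinner_matrix cnj_cinner complex_cnj(1) cnj.sel(1))
    have c2: "Re (cinner x r) = Re (cinner r x)"
      by (metis cnj_cinner cnj.sel(1))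
    have fy: "f y = l + 2 * t * Re (cinner r (A *v x)) + t\<^sup>2 * f r"
      using c1 by (simp add: f_def y_def l_def vec.add vec.scale vector_scalar_commute cinner_add_left cinner_add_right
          cinner_scale_left cinner_scale_right power2_eq_square algebra_simps)
    have "complex_of_real ((norm y)\<^sup>2) = cinner y y" by (simp add: cinner_self)
    hence "(norm y)\<^sup>2 = Re (cinner y y)" by (metis Re_complex_of_real)
    also have "\<dots> = 1 + 2 * t * Re (cinner r x) + t\<^sup>2 * (norm r)\<^sup>2"
      using c2 by (simp add: y_def cinner_add_left cinner_add_right cinner_self[of x] cinner_self[of r] nx
          cinner_scale_left cinner_scale_right power2_eq_square algebra_simps)
    finally have ny: "(norm y)\<^sup>2 = \<dots>" .
    have "(norm r)\<^sup>2 = Re (cinner r r)" by (simp add: cinner_self)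
    also have "\<dots> = Re (cinner r (A *v x)) - l * Re (cinner r x)"
      by (subst (2) r_def) (simp add: cinner_diff_right cinner_scale_right)
    finally have nr: "(norm r)\<^sup>2 = \<dots>" .
    have "t * (2 * (norm r)\<^sup>2) \<le> t * (t * k)"
      using bound[OF \<open>y \<in> W\<close>] unfolding fy ny k_def
      by (subst nr) (simp add: algebra_simps power2_eq_square)
    thus ?thesis using t by simp
  qed
  have "(norm r)\<^sup>2 \<le> 0"
  proof (rule ccontr)
    assume "\<not> ?thesis"
    hence pos: "(norm r)\<^sup>2 > 0" by simp
    \<comment> \<open>This value of \<open>t\<close> is small enough that \<open>t * k\<close> is at
      most \<open>(norm r)\<^sup>2\<close>.\<close>
    have "2 * (norm r)\<^sup>2 \<le> (norm r)\<^sup>2 / (\<bar>k\<bar> + 1) * k"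
      using pos by (intro ineq) auto
    also have "\<dots> \<le> (norm r)\<^sup>2 * 1"
      unfolding times_divide_eq_left times_divide_eq_right[symmetric]
      by (intro mult_left_mono) (auto simp: divide_simps)
    finally show False using pos by simp
  qed
  hence "A *v x = complex_of_real l *s x" by (simp add: r_def)
  thus ?thesis using xW nx cinner_self[of x] by auto
qed

definition diag_mat :: "('n \<Rightarrow> real) \<Rightarrow> complex^'n^'n" where
  "diag_mat d = (\<chi> i j. if i = j then complex_of_real (d i) else 0)"

definition unitary :: "complex^'n^'n \<Rightarrow> bool" where
  "unitary U \<longleftrightarrow> adjoint_mat U ** U = mat 1 \<and> U ** adjoint_mat U = mat 1"

definition diagonalizes :: "complex^'n^'n \<Rightarrow> ('n \<Rightarrow> real) \<Rightarrow> complex^'n^'n \<Rightarrow> bool" where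
  "diagonalizes U d A \<longleftrightarrow> unitary U \<and> A = U ** diag_mat d ** adjoint_mat U"

definition orthonormal :: "(complex^'n) set \<Rightarrow> bool" where
  "orthonormal B \<longleftrightarrow> (\<forall>u\<in>B. \<forall>v\<in>B. cinner u v = (if u = v then 1 else 0))"

lemma orthonormal_independent:
  fixes B :: "(complex^'n) set"
  assumes "orthonormal B"
  shows "vec.independent B"
proof
  assume "vec.dependent B"
  then obtain t u v where t: "finite t" "t \<subseteq> B" "v \<in> t" "u v \<noteq> 0" "(\<Sum>v\<in>t. u v *s v) = 0"
    unfolding vec.dependent_explicit by blast
  have "0 = cinner v (\<Sum>v\<in>t. u v *s v)" using t(5) by (simp add: cinner_def)
  also have "\<dots> = (\<Sum>w\<in>t. u w * cinner v w)" by (simp add: cinner_sum_right cinner_scale_right)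
  also have "\<dots> = (\<Sum>w\<in>t. if w = v then u v else 0)"
    using assms t(2,3) unfolding orthonormal_def by (intro sum.cong) (auto simp: subset_iff)
  also have "\<dots> = u v" using t by simp
  finally show False using t by simp
qed

text \<open>Take an orthonormal set of eigenvectors of largest cardinality. Its orthogonal
  complement \<open>W\<close> is invariant, and a nonzero vector in it would yield a further
  eigenvector; so the set spans, and its members are the columns of \<open>U\<close>.\<close>

theorem hermitian_diagonalizes:
  fixes A :: "complex^'n^'n"
  assumes A: "hermitian A"
  shows "\<exists>U d. diagonalizes U d A"
proof -
  define P where "P B \<longleftrightarrow> orthonormal B \<and> (\<forall>b\<in>B. \<exists>l. A *v b = complex_of_real l *s b)" for B
  have fin: "finite B \<and> card B \<le> CARD('n)" if "P B" for B
  proof -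
    have ind: "vec.independent B" using that orthonormal_independent P_def by blast
    hence "finite B" by (rule vec.finiteI_independent)
    thus ?thesis using vec.independent_card_le_dim[OF subset_UNIV ind] by (metis vec_dim_card)
  qed
  have "P {}" by (simp add: P_def orthonormal_def)
  then obtain B where B: "P B" and max: "\<And>C. P C \<Longrightarrow> card C \<le> card B"
    using ex_has_greatest_nat[of P "{}" card "CARD('n) + 1"] fin by (auto simp: less_Suc_eq_le)
  have on: "orthonormal B" using B P_def by blast
  have finB: "finite B" using fin B by blast
  define W where "W = {x. \<forall>b\<in>B. cinner b x = 0}"
  have W0: "x = 0" if "x \<in> W" for x
  proof (rule ccontr)
    assume "x \<noteq> 0"
    have closed: "closed W"
    proof -
      have "W = (\<Inter>b\<in>B. {x. cinner b x = 0})" by (auto simp: W_def)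
      thus ?thesis by (auto intro!: closed_INT closed_Collect_eq continuous_on_cinner continuous_on_const continuous_on_id)
    qed
    have inv: "A *v y \<in> W" if "y \<in> W" for y
    proof -
      have "cinner b (A *v y) = 0" if "b \<in> B" for b
      proof -
        obtain l where "A *v b = complex_of_real l *s b" using B \<open>b \<in> B\<close> P_def by blast
        thus ?thesis using A \<open>y \<in> W\<close> \<open>b \<in> B\<close>
          by (simp add: cinner_matrix hermitian_def cinner_scale_left W_def)
      qed
      thus ?thesis by (simp add: W_def)
    qed
    obtain y l where y: "y \<in> W" "cinner y y = 1" "A *v y = complex_of_real l *s y"
      using rayleigh_eigenvector[OF A closed _ _ inv \<open>x \<in> W\<close> \<open>x \<noteq> 0\<close>]
      by (auto simp: W_def cinner_add_right cinner_scale_right)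
    have perp: "cinner b y = 0 \<and> cinner y b = 0" if "b \<in> B" for b
      using y(1) that cnj_cinner[of b y] by (auto simp: W_def)
    hence "y \<notin> B" using y(2) by force
    have "P (insert y B)"
      using B perp y \<open>y \<notin> B\<close> unfolding P_def orthonormal_def by auto
    thus False using max[of "insert y B"] \<open>y \<notin> B\<close> finB by simp
  qed
  have "x \<in> vec.span B" for x
  proof -
    \<comment> \<open>Subtracting the orthogonal projection onto the span of \<open>B\<close> leaves
      a vector of \<open>W\<close>, hence 0.\<close>
    have "x - (\<Sum>b\<in>B. cinner b x *s b) \<in> W"
    proof -
      have "cinner c (\<Sum>b\<in>B. cinner b x *s b) = cinner c x" if "c \<in> B" for c
      proof -
        have "(\<Sum>b\<in>B. cinner b x * cinner c b) = (\<Sum>b\<in>B. if b = c then cinner c x else 0)"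
          using on that unfolding orthonormal_def by (intro sum.cong) auto
        thus ?thesis using that finB by (simp add: cinner_sum_right cinner_scale_right)
      qed
      thus ?thesis by (simp add: W_def cinner_diff_right)
    qed
    hence "x = (\<Sum>b\<in>B. cinner b x *s b)" using W0 by fastforce
    also have "\<dots> \<in> vec.span B"
      by (intro vec.span_sum vec.span_scale vec.span_base)
    finally show ?thesis .
  qed
  hence "vec.span B = UNIV" by blast
  hence "card B = CARD('n)"
    using vec.dim_eq_card[of B UNIV] orthonormal_independent[OF on] by (metis vec_dim_card vec.span_UNIV)
  then obtain h :: "'n \<Rightarrow> complex^'n" where h: "bij_betw h UNIV B"
    using finB by (metis finite_same_card_bij finite)
  hence hB: "h i \<in> B" for i by (auto simp: bij_betw_def)
  have hinj: "h i = h j \<longleftrightarrow> i = j" for i j using h by (auto simp: bij_betw_def inj_on_def)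
  define U where "U = (\<chi> i j. h j $ i)"
  have "(adjoint_mat U ** U) $ i $ j = (mat 1 :: complex^'n^'n) $ i $ j" for i j
  proof -
    have "(adjoint_mat U ** U) $ i $ j = cinner (h i) (h j)"
      by (simp add: adjoint_mat_def U_def matrix_matrix_mult_def cinner_def)
    thus ?thesis
      using on hB hinj unfolding orthonormal_def by (simp add: mat_def)
  qed
  hence U1: "adjoint_mat U ** U = mat 1"
    by (simp add: vec_eq_iff)
  hence U2: "U ** adjoint_mat U = mat 1" using matrix_left_right_inverse by blast
  have "\<forall>i. \<exists>l. A *v h i = complex_of_real l *s h i"
    using B hB unfolding P_def by blast
  from choice[OF this] obtain d where d: "\<And>i. A *v h i = complex_of_real (d i) *s h i"
    by blast
  have "(A ** U) $ i $ j = (U ** diag_mat d) $ i $ j" for i j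
  proof -
    have "(A ** U) $ i $ j = (A *v h j) $ i"
      by (simp add: U_def matrix_matrix_mult_def matrix_vector_mult_def)
    thus ?thesis
      by (simp add: d U_def matrix_matrix_mult_def diag_mat_def if_distrib[of "\<lambda>x. _ * x"]
          mult.commute cong: if_cong)
  qed
  hence "A ** U = U ** diag_mat d" by (simp add: vec_eq_iff)
  hence "A = U ** diag_mat d ** adjoint_mat U"
    by (metis U2 matrix_mul_assoc matrix_mul_rid)
  thus ?thesis using U1 U2 by (auto simp: diagonalizes_def unitary_def)
qed

section \<open>Algebra of matrix products and traces\<close>

lemma scaleR_matrix_mult_left: "(r *\<^sub>R A) ** B = r *\<^sub>R (A ** B)" for A :: "complex^'n^'m"
  by (simp add: matrix_matrix_mult_def vec_eq_iff scaleR_sum_right)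

lemma scaleR_matrix_mult_right: "A ** (r *\<^sub>R B) = r *\<^sub>R (A ** B)" for A :: "complex^'n^'m"
  by (simp add: matrix_matrix_mult_def vec_eq_iff scaleR_sum_right)

lemma matrix_diff_ldistrib: "A ** (B - C) = A ** B - A ** C" for A :: "complex^'n^'m"
  by (simp add: matrix_matrix_mult_def vec_eq_iff right_diff_distrib sum_subtractf)

lemma matrix_diff_rdistrib: "(A - B) ** C = A ** C - B ** C" for A :: "complex^'n^'m"
  by (simp add: matrix_matrix_mult_def vec_eq_iff left_diff_distrib sum_subtractf)

lemma matrix_add_rdistrib: "(A + B) ** C = A ** C + B ** C" for A :: "complex^'n^'m"
  by (simp add: matrix_matrix_mult_def vec_eq_iff distrib_right sum.distrib)

lemma trace_scaleR: "trace (r *\<^sub>R A) = r *\<^sub>R trace A" for A :: "complex^'n^'n"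
  by (simp add: trace_def scaleR_sum_right)

lemma trace_adjoint_mult:
  "trace (adjoint_mat A ** B) = (\<Sum>i\<in>UNIV. \<Sum>j\<in>UNIV. cnj (A $ i $ j) * B $ i $ j)"
  unfolding trace_def matrix_matrix_mult_def adjoint_mat_def
  by (simp, rule sum.swap)

text \<open>The trace pairing is nondegenerate: matrix units as \<open>Y\<close> read off the
  entries. Identities for partial traces are derived this way from duality alone.\<close>

lemma trace_mult_eqI:
  fixes A B :: "complex^'n^'n"
  assumes "\<And>Y. trace (Y ** A) = trace (Y ** B)"
  shows "A = B"
proof -
  have "trace (outer (axis j 1) (axis i 1) ** C) = C $ i $ j" for i j :: 'n and C :: "complex^'n^'n"
    by (simp add: trace_def matrix_matrix_mult_def outer_def axis_def if_distrib[of "\<lambda>x. x * _"]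
        if_distrib[of cnj] if_distrib[of "\<lambda>x. _ * x"] cong: if_cong)
  thus ?thesis using assms by (metis vec_eq_iff)
qed

section \<open>Positive semidefinite matrices\<close>

definition psd :: "complex^'n^'n \<Rightarrow> bool" where
  "psd A \<longleftrightarrow> hermitian A \<and> (\<forall>v. Re (cinner v (A *v v)) \<ge> 0)"

lemma adjoint_add: "adjoint_mat (A + B) = adjoint_mat A + adjoint_mat B"
  by (simp add: adjoint_mat_def vec_eq_iff)

lemma adjoint_scaleR: "adjoint_mat (r *\<^sub>R A) = r *\<^sub>R adjoint_mat A"
  by (simp add: adjoint_mat_def vec_eq_iff)

lemma psd_add: "psd A \<Longrightarrow> psd B \<Longrightarrow> psd (A + B)"
  by (simp add: psd_def hermitian_def adjoint_add matrix_vector_mult_add_rdistrib cinner_add_right)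

lemma psd_scaleR:
  assumes "psd A" "r \<ge> 0"
  shows "psd (r *\<^sub>R A)"
proof -
  have "cinner v ((r *\<^sub>R A) *v v) = r *\<^sub>R cinner v (A *v v)" for v
    by (simp add: cinner_def matrix_vector_mult_def sum_distrib_left scaleR_sum_right)
  thus ?thesis using assms by (simp add: psd_def hermitian_def adjoint_scaleR)
qed

lemma psd_congruence: "psd A \<Longrightarrow> psd (adjoint_mat B ** A ** B)"
  by (simp add: psd_def hermitian_def adjoint_mult matrix_mul_assoc
      cinner_matrix[of _ "adjoint_mat B"] flip: matrix_vector_mul_assoc)

lemma psd_diag: "psd A \<Longrightarrow> Re (A $ i $ i) \<ge> 0"
proof -
  assume "psd A"
  hence "0 \<le> Re (cinner (axis i 1) (A *v axis i 1))" unfolding psd_def by blast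
  also have "cinner (axis i 1) (A *v axis i 1) = A $ i $ i"
    by (simp add: cinner_def matrix_vector_mult_def axis_def if_distrib[of "\<lambda>x. x * _"]
        if_distrib[of cnj] if_distrib[of "\<lambda>x. _ * x"] cong: if_cong)
  finally show ?thesis .
qed

lemma psd_trace: "psd A \<Longrightarrow> Re (trace A) \<ge> 0"
  by (simp add: trace_def sum_nonneg psd_diag)

section \<open>Eigenvalues, traces and entropy in an eigenbasis\<close>

lemma diagonalizes_eigenvalue:
  assumes "diagonalizes U d A"
  shows "adjoint_mat U ** A ** U = diag_mat d"
  using assms unfolding diagonalizes_def unitary_def
  by (metis matrix_mul_assoc matrix_mul_lid matrix_mul_rid)

lemma diagonalizes_nonneg:
  assumes "diagonalizes U d A" "psd A"
  shows "d i \<ge> 0"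
  using psd_diag[OF psd_congruence[OF assms(2), of U], of i]
  unfolding diagonalizes_eigenvalue[OF assms(1)] by (simp add: diag_mat_def)

lemma psd_diagonalizes: "psd A \<Longrightarrow> \<exists>U d. diagonalizes U d A"
  using hermitian_diagonalizes psd_def by blast

lemma diag_mat_mult_left: "(diag_mat d ** A) $ i $ j = complex_of_real (d i) * A $ i $ j"
  by (simp add: diag_mat_def matrix_matrix_mult_def if_distrib[of "\<lambda>x. x * _"] cong: if_cong)

lemma diag_mat_mult_right: "(A ** diag_mat d) $ i $ j = A $ i $ j * complex_of_real (d j)"
  by (simp add: diag_mat_def matrix_matrix_mult_def if_distrib[of "\<lambda>x. _ * x"] cong: if_cong)

lemma trace_diag_mat: "trace (diag_mat d) = complex_of_real (\<Sum>i\<in>UNIV. d i)"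
  by (simp add: trace_def diag_mat_def)

lemma trace_unitary_conj:
  assumes "unitary U"
  shows "trace (U ** A ** adjoint_mat U) = trace A"
  using assms unfolding unitary_def by (metis matrix_mul_assoc matrix_mul_lid trace_mul_sym)

lemma diagonalizes_trace: "diagonalizes U d A \<Longrightarrow> trace A = complex_of_real (\<Sum>i\<in>UNIV. d i)"
  by (metis diagonalizes_def trace_diag_mat trace_unitary_conj)

text \<open>The factor \<open>ln 2\<close> passes to natural logarithms, which the integral formula
  below produces. A zero eigenvalue contributes 0.\<close>

lemma vn_entropy_diagonalizes:
  fixes A :: "complex^'n^'n"
  assumes "diagonalizes U d A"
  shows "vn_entropy A * ln 2 = - (\<Sum>i\<in>UNIV. d i * ln (d i))"
proof -
  have U: "adjoint_mat U ** U = mat 1" "U ** adjoint_mat U = mat 1"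
    and A: "A = U ** diag_mat d ** adjoint_mat U"
    using assms by (auto simp: diagonalizes_def unitary_def)
  have "herm_fun (log 2) A = U ** diag_mat (\<lambda>i. log 2 (d i)) ** adjoint_mat U"
    using herm_fun_unitary_diag[OF U, of A d "log 2"] A by (simp add: diag_mat_def)
  hence "A ** herm_fun (log 2) A
      = U ** (diag_mat d ** diag_mat (\<lambda>i. log 2 (d i))) ** adjoint_mat U"
    by (metis A U(1) matrix_mul_assoc matrix_mul_rid)
  also have "diag_mat d ** diag_mat (\<lambda>i. log 2 (d i)) = diag_mat (\<lambda>i. d i * log 2 (d i))"
    by (simp add: vec_eq_iff diag_mat_mult_left) (simp add: diag_mat_def)
  finally have "trace (A ** herm_fun (log 2) A) = complex_of_real (\<Sum>i\<in>UNIV. d i * log 2 (d i))"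
    using assms by (simp add: diagonalizes_def trace_unitary_conj trace_diag_mat)
  thus ?thesis
    by (simp add: vn_entropy_def log_def sum_distrib_right)
qed

subsection \<open>Integral representation of the entropy gap\<close>

text \<open>The transition probabilities between the columns of \<open>U\<close> and those of
  \<open>V\<close>; for unitary matrices they form a doubly stochastic table.\<close>

definition overlap :: "complex^'n^'n \<Rightarrow> complex^'n^'n \<Rightarrow> 'n \<Rightarrow> 'n \<Rightarrow> real" where
  "overlap U V i j = (cmod ((adjoint_mat U ** V) $ i $ j))\<^sup>2"

lemma overlap_nonneg [simp]: "overlap U V i j \<ge> 0"
  by (simp add: overlap_def)

lemma complex_of_real_cmod_square: "complex_of_real ((cmod z)\<^sup>2) = cnj z * z"
  by (metis complex_norm_square mult.commute)

text \<open>Expanding \<rho> in its eigenbasis shows that its diagonal in the basis \<open>V\<close>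
  mixes the eigenvalues \<open>p\<close> with the overlaps as weights.\<close>

lemma overlap_diagonalizes:
  assumes "diagonalizes U p \<rho>"
  shows "(\<Sum>i\<in>UNIV. overlap U V i j * p i) = Re ((adjoint_mat V ** \<rho> ** V) $ j $ j)"
proof -
  define C where "C = adjoint_mat U ** V"
  have "adjoint_mat V ** \<rho> ** V = adjoint_mat C ** (diag_mat p ** C)"
    using assms by (simp add: diagonalizes_def C_def adjoint_mult matrix_mul_assoc)
  hence "(adjoint_mat V ** \<rho> ** V) $ j $ j
      = (\<Sum>i\<in>UNIV. cnj (C $ i $ j) * (diag_mat p ** C) $ i $ j)"
    by (simp add: matrix_matrix_mult_def adjoint_mat_def)
  also have "\<dots> = complex_of_real (\<Sum>i\<in>UNIV. overlap U V i j * p i)"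
    unfolding of_real_sum of_real_mult overlap_def complex_of_real_cmod_square
    by (simp add: diag_mat_mult_left C_def mult_ac)
  finally show ?thesis by simp
qed

lemma overlap_swap: "overlap U V i j = overlap V U j i"
proof -
  have "(adjoint_mat U ** V) $ i $ j = cnj ((adjoint_mat V ** U) $ j $ i)"
    by (simp add: matrix_matrix_mult_def adjoint_mat_def mult.commute)
  thus ?thesis by (simp add: overlap_def)
qed

text \<open>This is \<open>overlap_diagonalizes\<close> for the identity matrix, all of whose
  eigenvalues are 1.\<close>

lemma overlap_sum_left:
  fixes U V :: "complex^'n^'n"
  assumes "unitary U" "unitary V"
  shows "(\<Sum>i\<in>UNIV. overlap U V i j) = 1"
proof -
  have "diagonalizes U (\<lambda>_. 1) (mat 1)"
  proof -
    have "(diag_mat (\<lambda>_. 1) :: complex^'n^'n) = mat 1" by (simp add: diag_mat_def mat_def vec_eq_iff)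
    thus ?thesis using assms by (simp add: diagonalizes_def unitary_def)
  qed
  from overlap_diagonalizes[OF this, of V j] show ?thesis
    using assms by (simp add: unitary_def) (simp add: mat_def)
qed

lemma overlap_sum_right:
  assumes "unitary U" "unitary V"
  shows "(\<Sum>j\<in>UNIV. overlap U V i j) = 1"
  using overlap_sum_left[OF assms(2,1), of i] by (simp add: overlap_swap[of V U])

section \<open>The variational formula for \<open>F\<^sub>u\<close>\<close>

definition chi_var :: "real \<Rightarrow> complex^'n^'n \<Rightarrow> complex^'n^'n \<Rightarrow> complex^'n^'n \<Rightarrow> real" where
  "chi_var u \<rho> \<sigma> Y = 2 * Re (trace (adjoint_mat Y ** (\<rho> - \<sigma>)))
     - u * Re (trace (adjoint_mat Y ** \<rho> ** Y)) - (1 - u) * Re (trace (Y ** \<sigma> ** adjoint_mat Y))"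

text \<open>This is \<open>F\<^sub>u\<close> in eigenbases. For \<open>0 < u < 1\<close> and
  nonnegative eigenvalues a denominator vanishes only if both eigenvalues do, and division by zero
  then gives the intended 0.\<close>

definition chi_sum ::
    "real \<Rightarrow> complex^'n^'n \<Rightarrow> ('n \<Rightarrow> real) \<Rightarrow> complex^'n^'n \<Rightarrow> ('n \<Rightarrow> real) \<Rightarrow> real" where
  "chi_sum u U p V q =
     (\<Sum>i\<in>UNIV. \<Sum>j\<in>UNIV. overlap U V i j * ((p i - q j)\<^sup>2 / (u * p i + (1 - u) * q j)))"

text \<open>In the mixed basis \<rho> on the left scales the rows of \<open>Z\<close> by
  \<open>p\<close> and \<sigma> on the right scales its columns by \<open>q\<close>. The quadratic
  functional thus splits into independent problems, one per entry of \<open>Z\<close>.\<close>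

lemma chi_var_diagonalizes:
  fixes \<rho> \<sigma> Y :: "complex^'n^'n"
  assumes \<rho>: "diagonalizes U p \<rho>" and \<sigma>: "diagonalizes V q \<sigma>"
    and C: "C = adjoint_mat U ** V" and Z: "Z = adjoint_mat U ** Y ** V"
  shows "chi_var u \<rho> \<sigma> Y = (\<Sum>i\<in>UNIV. \<Sum>j\<in>UNIV.
    2 * (p i - q j) * Re (cnj (Z $ i $ j) * C $ i $ j)
      - (u * p i + (1 - u) * q j) * (cmod (Z $ i $ j))\<^sup>2)"
proof -
  have U: "adjoint_mat U ** U = mat 1" "U ** adjoint_mat U = mat 1"
    and V: "adjoint_mat V ** V = mat 1" "V ** adjoint_mat V = mat 1"
    using \<rho> \<sigma> by (auto simp: diagonalizes_def unitary_def)
  have *: "trace (adjoint_mat Y ** M) = trace (adjoint_mat Z ** (adjoint_mat U ** M ** V))" for M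
  proof -
    have "trace (adjoint_mat Z ** (adjoint_mat U ** M ** V))
        = trace (adjoint_mat V ** (adjoint_mat Y ** (U ** adjoint_mat U) ** M ** V))"
      by (simp add: Z adjoint_mult matrix_mul_assoc)
    also have "\<dots> = trace (adjoint_mat Y ** M ** (V ** adjoint_mat V))"
      by (subst trace_mul_sym) (simp add: U matrix_mul_assoc)
    finally show ?thesis by (simp add: V)
  qed
  have \<rho>Y: "adjoint_mat U ** (\<rho> ** M) ** V = diag_mat p ** (adjoint_mat U ** M ** V)" for M
    using \<rho> U unfolding diagonalizes_def by (metis matrix_mul_assoc matrix_mul_lid)
  have \<sigma>Y: "adjoint_mat U ** (M ** \<sigma>) ** V = (adjoint_mat U ** M ** V) ** diag_mat q" for M
    using \<sigma> V unfolding diagonalizes_def by (metis matrix_mul_assoc matrix_mul_rid)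
  have 1: "adjoint_mat U ** (\<rho> - \<sigma>) ** V = diag_mat p ** C - C ** diag_mat q"
    using \<rho>Y[of "mat 1"] \<sigma>Y[of "mat 1"]
    by (simp add: C matrix_diff_ldistrib matrix_diff_rdistrib)
  have "trace (adjoint_mat Y ** (\<rho> - \<sigma>))
      = (\<Sum>i\<in>UNIV. \<Sum>j\<in>UNIV. complex_of_real (p i - q j) * (cnj (Z $ i $ j) * C $ i $ j))"
    unfolding * 1
    unfolding trace_adjoint_mult
    by (simp add: diag_mat_mult_left diag_mat_mult_right algebra_simps)
  hence t1: "Re (trace (adjoint_mat Y ** (\<rho> - \<sigma>)))
      = (\<Sum>i\<in>UNIV. \<Sum>j\<in>UNIV. (p i - q j) * Re (cnj (Z $ i $ j) * C $ i $ j))"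
    by (simp del: of_real_diff)
  have "trace (adjoint_mat Y ** \<rho> ** Y) = trace (adjoint_mat Z ** (diag_mat p ** Z))"
    unfolding matrix_mul_assoc[symmetric, of "adjoint_mat Y"] * \<rho>Y Z ..
  also have "\<dots> = complex_of_real (\<Sum>i\<in>UNIV. \<Sum>j\<in>UNIV. p i * (cmod (Z $ i $ j))\<^sup>2)"
    unfolding trace_adjoint_mult of_real_sum of_real_mult complex_of_real_cmod_square
    by (simp add: diag_mat_mult_left mult_ac)
  finally have t2: "Re (trace (adjoint_mat Y ** \<rho> ** Y))
      = (\<Sum>i\<in>UNIV. \<Sum>j\<in>UNIV. p i * (cmod (Z $ i $ j))\<^sup>2)"
    by (simp only: Re_complex_of_real)
  have "trace (Y ** \<sigma> ** adjoint_mat Y) = trace (adjoint_mat Y ** (Y ** \<sigma>))"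
    by (rule trace_mul_sym)
  also have "\<dots> = trace (adjoint_mat Z ** (Z ** diag_mat q))"
    unfolding * \<sigma>Y Z ..
  also have "\<dots> = complex_of_real (\<Sum>i\<in>UNIV. \<Sum>j\<in>UNIV. q j * (cmod (Z $ i $ j))\<^sup>2)"
    unfolding trace_adjoint_mult of_real_sum of_real_mult complex_of_real_cmod_square
    by (simp add: diag_mat_mult_right mult_ac)
  finally have t3: "Re (trace (Y ** \<sigma> ** adjoint_mat Y))
      = (\<Sum>i\<in>UNIV. \<Sum>j\<in>UNIV. q j * (cmod (Z $ i $ j))\<^sup>2)"
    by (simp only: Re_complex_of_real)
  have "2 * (d * x) - u * (a * z) - (1 - u) * (b * z) = 2 * d * x - (u * a + (1 - u) * b) * z"
    for d x a b z
    by (simp add: algebra_simps)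
  thus ?thesis
    unfolding chi_var_def t1 t2 t3 sum_distrib_left sum_subtractf[symmetric]
    by (simp only:)
qed

text \<open>Completing the square in \<open>cmod z\<close>; when \<open>w = 0\<close>, both sides
  vanish.\<close>

lemma quadratic_le:
  fixes w d :: real
  assumes "w \<ge> 0" and "w = 0 \<Longrightarrow> d = 0"
  shows "2 * d * Re (cnj z * c) - w * (cmod z)\<^sup>2 \<le> (cmod c)\<^sup>2 * (d\<^sup>2 / w)"
proof (cases "w = 0")
  case False
  hence w: "w > 0" using assms by simp
  have "d * Re (cnj z * c) \<le> \<bar>d\<bar> * (cmod z * cmod c)"
  proof -
    have "\<bar>d * Re (cnj z * c)\<bar> \<le> \<bar>d\<bar> * (cmod z * cmod c)"
      using abs_Re_le_cmod[of "cnj z * c"]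
      by (simp add: abs_mult norm_mult mult_left_mono del: times_complex.simps)
    thus ?thesis by linarith
  qed
  moreover have "0 \<le> (w * cmod z - \<bar>d\<bar> * cmod c)\<^sup>2 / w" using w by simp
  hence "2 * (\<bar>d\<bar> * (cmod z * cmod c)) - w * (cmod z)\<^sup>2 \<le> (cmod c)\<^sup>2 * (d\<^sup>2 / w)"
    using w by (simp add: power2_diff power_mult_distrib field_simps power2_eq_square)
  ultimately show ?thesis by linarith
qed (use assms in simp)

lemma chi_weight:
  fixes p q u :: real
  assumes "p \<ge> 0" "q \<ge> 0" "0 < u" "u < 1"
  shows "u * p + (1 - u) * q \<ge> 0" "u * p + (1 - u) * q = 0 \<Longrightarrow> p - q = 0"
  using assms by (auto simp: add_nonneg_eq_0_iff)

lemma chi_var_le_chi_sum: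
  fixes \<rho> \<sigma> :: "complex^'n^'n"
  assumes \<rho>: "diagonalizes U p \<rho>" "psd \<rho>" and \<sigma>: "diagonalizes V q \<sigma>" "psd \<sigma>"
    and u: "0 < u" "u < 1"
  shows "chi_var u \<rho> \<sigma> Y \<le> chi_sum u U p V q"
  unfolding chi_var_diagonalizes[OF \<rho>(1) \<sigma>(1) refl refl] chi_sum_def overlap_def
  using diagonalizes_nonneg[OF \<rho>] diagonalizes_nonneg[OF \<sigma>] u
  by (intro sum_mono quadratic_le chi_weight)

text \<open>Each entry of \<open>Z\<close> is put at the vertex of its parabola. Where the weight is
  0, division by zero makes the entry and both sides of \<open>eq\<close> zero.\<close>

lemma chi_sum_attained:
  fixes \<rho> \<sigma> :: "complex^'n^'n"
  assumes \<rho>: "diagonalizes U p \<rho>" and \<sigma>: "diagonalizes V q \<sigma>"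
  shows "\<exists>Y. chi_var u \<rho> \<sigma> Y = chi_sum u U p V q"
proof -
  define C where "C = adjoint_mat U ** V"
  define Z :: "complex^'n^'n" where
    "Z = (\<chi> i j. complex_of_real ((p i - q j) / (u * p i + (1 - u) * q j)) * C $ i $ j)"
  have "adjoint_mat U ** (U ** Z ** adjoint_mat V) ** V = Z"
    using \<rho> \<sigma> unfolding diagonalizes_def unitary_def
    by (metis matrix_mul_assoc matrix_mul_lid matrix_mul_rid)
  note * = chi_var_diagonalizes[OF \<rho> \<sigma> C_def this[symmetric], of u]
  have eq: "2 * d * Re (cnj (complex_of_real (d / w) * c) * c) - w * (cmod (complex_of_real (d / w) * c))\<^sup>2
      = (cmod c)\<^sup>2 * (d\<^sup>2 / w)" for w d :: real and c
  proof -
    have "cnj (complex_of_real (d / w) * c) * c = complex_of_real (d / w * (cmod c)\<^sup>2)"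
      unfolding of_real_mult complex_of_real_cmod_square by simp
    hence "Re (cnj (complex_of_real (d / w) * c) * c) = d / w * (cmod c)\<^sup>2"
      by (metis Re_complex_of_real)
    moreover have "(cmod (complex_of_real (d / w) * c))\<^sup>2 = (d / w)\<^sup>2 * (cmod c)\<^sup>2"
      by (simp only: norm_mult norm_of_real power_mult_distrib power2_abs)
    ultimately show ?thesis
      by (cases "w = 0") (simp_all add: power2_eq_square field_simps del: times_complex.simps)
  qed
  have "chi_var u \<rho> \<sigma> (U ** Z ** adjoint_mat V) = chi_sum u U p V q"
    unfolding * chi_sum_def overlap_def C_def[symmetric]
    by (intro sum.cong refl) (simp only: Z_def vec_lambda_beta eq)
  thus ?thesis ..
qed

text \<open>Taylor's formula at \<open>q\<close> for \<open>x ln x\<close>, whose second derivative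
  is \<open>1 / x\<close>, with the remainder in integral form.\<close>

lemma bregman_integral:
  fixes p q :: real
  assumes "p \<ge> 0" "q \<ge> 0" "q = 0 \<Longrightarrow> p = 0"
  shows "((\<lambda>u. (1 - u) * ((p - q)\<^sup>2 / (u * p + (1 - u) * q)))
    has_integral (p * ln p - p * ln q - p + q)) {0<..<1}"
proof -
  let ?f = "\<lambda>u. (1 - u) * ((p - q)\<^sup>2 / (u * p + (1 - u) * q))"
  consider "q = 0" "p = 0" | "q > 0" "p = 0" | "q > 0" "p > 0"
    using assms by fastforce
  hence "(?f has_integral (p * ln p - p * ln q - p + q)) {0..1}"
  proof cases
    case 1
    thus ?thesis by simp
  next
    case 2
    have "(?f has_integral (\<lambda>u. q * u) 1 - (\<lambda>u. q * u) 0) {0..1}"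
    proof (rule fundamental_theorem_of_calculus_interior)
      fix x :: real assume "x \<in> {0<..<1}"
      hence "?f x = q" using 2 by (simp add: field_simps power2_eq_square)
      thus "((\<lambda>u. q * u) has_vector_derivative ?f x) (at x)"
        by (auto intro!: derivative_eq_intros simp: has_real_derivative_iff_has_vector_derivative[symmetric])
    qed (auto intro!: continuous_intros)
    thus ?thesis using 2 by simp
  next
    case 3
    \<comment> \<open>With \<open>x = u * p + (1 - u) * q\<close> the derivative is
      \<open>(p - q) * (p - x) / x\<close>, and \<open>p - x = (1 - u) * (p - q)\<close>.\<close>
    let ?g = "\<lambda>u. p * ln (u * p + (1 - u) * q) - (u * p + (1 - u) * q)"
    have pos: "u * p + (1 - u) * q > 0" if "0 \<le> u" "u \<le> 1" for u
      using that 3 by (cases "u = 0") (auto intro!: add_pos_nonneg)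
    have "(?f has_integral ?g 1 - ?g 0) {0..1}"
      (is "(_ has_integral ?I) _")
    proof (rule fundamental_theorem_of_calculus_interior)
      fix x :: real assume "x \<in> {0<..<1}"
      hence "x * p + (1 - x) * q > 0" by (intro pos) auto
      moreover from this have "(?g has_real_derivative
          p * (1 / (x * p + (1 - x) * q) * (p - q)) - (p - q)) (at x)"
        by (auto intro!: derivative_eq_intros)
      moreover from calculation(1) have "p * (1 / (x * p + (1 - x) * q) * (p - q)) - (p - q) = ?f x"
        by (simp add: field_simps power2_eq_square)
      ultimately show "(?g has_vector_derivative ?f x) (at x)"
        by (simp add: has_real_derivative_iff_has_vector_derivative)
    next
      have "u * p + (1 - u) * q \<noteq> 0" if "u \<in> {0..1}" for u using pos[of u] that by auto
      thus "continuous_on {0..1} ?g" by (intro continuous_intros) auto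
    qed simp
    moreover have "?I = p * ln p - p * ln q - p + q" by simp
    ultimately show ?thesis by metis
  qed
  \<comment> \<open>The variational bounds hold for \<open>0 < u < 1\<close>, so later comparisons
    of integrands take place on the open interval.\<close>
  thus ?thesis by (simp add: has_integral_Icc_iff_Ioo)
qed

text \<open>Averaging \<open>bregman_integral\<close> with the overlaps as weights gives the
  relative entropy of \<rho> with respect to \<sigma>, in natural units, up to the difference of
  traces. \<open>supp\<close> says that \<rho> vanishes on the kernel of \<sigma>, which keeps it
  finite.\<close>

lemma chi_sum_integral:
  fixes \<rho> \<sigma> :: "complex^'n^'n"
  assumes \<rho>: "diagonalizes U p \<rho>" "psd \<rho>" and \<sigma>: "diagonalizes V q \<sigma>" "psd \<sigma>"
    and supp: "\<And>j. q j = 0 \<Longrightarrow> Re ((adjoint_mat V ** \<rho> ** V) $ j $ j) = 0"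
  shows "((\<lambda>u. (1 - u) * chi_sum u U p V q) has_integral
    ((\<Sum>i\<in>UNIV. p i * ln (p i)) - (\<Sum>j\<in>UNIV. Re ((adjoint_mat V ** \<rho> ** V) $ j $ j) * ln (q j))
      - Re (trace \<rho>) + Re (trace \<sigma>))) {0<..<1}"
proof -
  have UV: "unitary U" "unitary V" using \<rho> \<sigma> by (auto simp: diagonalizes_def)
  have p: "p i \<ge> 0" and q: "q i \<ge> 0" for i
    using diagonalizes_nonneg \<rho> \<sigma> by blast+
  define w where "w i j = overlap U V i j" for i j
  \<comment> \<open>The diagonal entry that \<open>supp\<close> sends to 0 is a sum of nonnegative
    terms \<open>w i j * p i\<close>.\<close>
  have w0: "w i j = 0 \<or> p i = 0" if "q j = 0" for i j
  proof -
    have "(\<Sum>i\<in>UNIV. w i j * p i) = 0"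
      using overlap_diagonalizes[OF \<rho>(1), of V j] supp[OF that] by (simp add: w_def)
    thus ?thesis using p by (simp add: sum_nonneg_eq_0_iff w_def)
  qed
  have "((\<lambda>u. w i j * ((1 - u) * ((p i - q j)\<^sup>2 / (u * p i + (1 - u) * q j)))) has_integral
      w i j * (p i * ln (p i) - p i * ln (q j) - p i + q j)) {0<..<1}" for i j
  proof (cases "w i j = 0")
    case False
    thus ?thesis using w0[of j i] p q by (intro has_integral_mult_right bregman_integral) auto
  qed simp
  hence "((\<lambda>u. \<Sum>i\<in>UNIV. \<Sum>j\<in>UNIV.
        w i j * ((1 - u) * ((p i - q j)\<^sup>2 / (u * p i + (1 - u) * q j)))) has_integral
      (\<Sum>i\<in>UNIV. \<Sum>j\<in>UNIV. w i j * (p i * ln (p i) - p i * ln (q j) - p i + q j))) {0<..<1}"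
    by (intro has_integral_sum) auto
  moreover have "(\<Sum>i\<in>UNIV. \<Sum>j\<in>UNIV. w i j * ((1 - u) * ((p i - q j)\<^sup>2 / (u * p i + (1 - u) * q j))))
      = (1 - u) * chi_sum u U p V q" for u
    by (simp add: chi_sum_def w_def sum_distrib_left mult_ac)
  moreover have "(\<Sum>i\<in>UNIV. \<Sum>j\<in>UNIV. w i j * (p i * ln (p i) - p i * ln (q j) - p i + q j))
      = (\<Sum>i\<in>UNIV. p i * ln (p i)) - (\<Sum>j\<in>UNIV. Re ((adjoint_mat V ** \<rho> ** V) $ j $ j) * ln (q j))
      - Re (trace \<rho>) + Re (trace \<sigma>)"
  proof -
    \<comment> \<open>Terms depending on one index collapse because the table is doubly stochastic;
      the cross term becomes the diagonal of \<rho> in the basis \<open>V\<close>.\<close>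
    have row: "(\<Sum>i\<in>UNIV. \<Sum>j\<in>UNIV. w i j * f i) = (\<Sum>i\<in>UNIV. f i)" for f
      using overlap_sum_right[OF UV] by (simp add: w_def flip: sum_distrib_right)
    have col: "(\<Sum>i\<in>UNIV. \<Sum>j\<in>UNIV. w i j * f j) = (\<Sum>i\<in>UNIV. f i)" for f
      using overlap_sum_left[OF UV] by (subst sum.swap) (simp add: w_def flip: sum_distrib_right)
    have mix: "(\<Sum>i\<in>UNIV. \<Sum>j\<in>UNIV. w i j * (p i * f j))
        = (\<Sum>j\<in>UNIV. Re ((adjoint_mat V ** \<rho> ** V) $ j $ j) * f j)" for f
      by (subst sum.swap)
        (simp add: w_def overlap_diagonalizes[OF \<rho>(1), symmetric] sum_distrib_right mult.assoc)
    show ?thesis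
      unfolding diagonalizes_trace[OF \<rho>(1)] diagonalizes_trace[OF \<sigma>(1)] Re_complex_of_real
        mix[symmetric] row[symmetric, of p] col[symmetric, of q] row[symmetric, of "\<lambda>i. p i * ln (p i)"]
      by (simp add: algebra_simps sum.distrib sum_subtractf)
  qed
  ultimately show ?thesis by simp
qed

text \<open>Add the relative entropies of both states with respect to their midpoint: the cross
  terms combine to the entropy of the midpoint and the traces cancel.\<close>

lemma entropy_gap_integral:
  fixes \<rho> \<rho>' :: "complex^'n^'n"
  assumes \<rho>: "diagonalizes U p \<rho>" "psd \<rho>" and \<rho>': "diagonalizes U' p' \<rho>'" "psd \<rho>'"
    and \<sigma>: "diagonalizes V q ((1/2) *\<^sub>R (\<rho> + \<rho>'))"
  shows "((\<lambda>u. (1 - u) * chi_sum u U p V q + (1 - u) * chi_sum u U' p' V q) has_integral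
    (2 * vn_entropy ((1/2) *\<^sub>R (\<rho> + \<rho>')) - vn_entropy \<rho> - vn_entropy \<rho>') * ln 2) {0<..<1}"
proof -
  let ?\<sigma> = "(1/2) *\<^sub>R (\<rho> + \<rho>')"
  have psd: "psd ?\<sigma>" using \<rho> \<rho>' by (intro psd_scaleR psd_add) auto
  define r where "r A j = Re ((adjoint_mat V ** A ** V) $ j $ j)" for A j
  have r_nonneg: "psd A \<Longrightarrow> r A j \<ge> 0" for A j
    unfolding r_def by (intro psd_diag psd_congruence)
  have "r ?\<sigma> j = q j" for j
    unfolding r_def diagonalizes_eigenvalue[OF \<sigma>] by (simp add: diag_mat_def)
  moreover have "r ?\<sigma> j = (r \<rho> j + r \<rho>' j) / 2" for j
    by (simp add: r_def scaleR_matrix_mult_left scaleR_matrix_mult_right matrix_add_ldistrib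
        matrix_add_rdistrib)
  ultimately have r: "r \<rho> j + r \<rho>' j = 2 * q j" for j by (metis field_sum_of_halves mult_2 add_divide_distrib)
  \<comment> \<open>Two nonnegative diagonal entries with sum \<open>2 * q j\<close> both vanish
    when \<open>q j\<close> does, so the midpoint dominates the supports of both states.\<close>
  have supp: "r \<rho> j = 0" "r \<rho>' j = 0" if "q j = 0" for j
    using r[of j] that r_nonneg[OF \<rho>(2), of j] r_nonneg[OF \<rho>'(2), of j] by auto
  have tr: "Re (trace ?\<sigma>) * 2 = Re (trace \<rho>) + Re (trace \<rho>')"
    by (simp add: trace_scaleR trace_add)
  have ent: "(\<Sum>j\<in>UNIV. r \<rho> j * ln (q j)) + (\<Sum>j\<in>UNIV. r \<rho>' j * ln (q j))
      = 2 * (\<Sum>j\<in>UNIV. q j * ln (q j))"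
    unfolding sum.distrib[symmetric] distrib_right[symmetric] r by (simp add: sum_distrib_left mult.assoc)
  from has_integral_add[OF chi_sum_integral[OF \<rho> \<sigma> psd supp(1)[unfolded r_def]]
      chi_sum_integral[OF \<rho>' \<sigma> psd supp(2)[unfolded r_def]]]
  show ?thesis
    unfolding r_def[symmetric]
  proof (rule has_integral_eq_rhs)
    show "(2 * vn_entropy ?\<sigma> - vn_entropy \<rho> - vn_entropy \<rho>') * ln 2
      = (\<Sum>i\<in>UNIV. p i * ln (p i)) - (\<Sum>j\<in>UNIV. r \<rho> j * ln (q j)) - Re (trace \<rho>) + Re (trace ?\<sigma>)
        + ((\<Sum>i\<in>UNIV. p' i * ln (p' i)) - (\<Sum>j\<in>UNIV. r \<rho>' j * ln (q j)) - Re (trace \<rho>')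
          + Re (trace ?\<sigma>))"
      using tr ent vn_entropy_diagonalizes[OF \<rho>(1)] vn_entropy_diagonalizes[OF \<rho>'(1)]
        vn_entropy_diagonalizes[OF \<sigma>]
      unfolding left_diff_distrib mult.assoc by linarith
  qed
qed

lemma chi_sum_nonneg:
  assumes "\<And>i. p i \<ge> 0" "\<And>i. q i \<ge> 0" "0 < u" "u < 1"
  shows "chi_sum u U p V q \<ge> 0"
  unfolding chi_sum_def using assms
  by (intro sum_nonneg mult_nonneg_nonneg divide_nonneg_nonneg chi_weight) auto

lemma vn_entropy_midpoint_concave:
  fixes \<rho> \<rho>' :: "complex^'n^'n"
  assumes "psd \<rho>" "psd \<rho>'"
  shows "vn_entropy \<rho> + vn_entropy \<rho>' \<le> 2 * vn_entropy ((1/2) *\<^sub>R (\<rho> + \<rho>'))"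
proof -
  let ?\<sigma> = "(1/2) *\<^sub>R (\<rho> + \<rho>')"
  have psd: "psd ?\<sigma>" using assms by (intro psd_scaleR psd_add) auto
  obtain U p U' p' V q where d: "diagonalizes U p \<rho>" "diagonalizes U' p' \<rho>'" "diagonalizes V q ?\<sigma>"
    using assms psd psd_diagonalizes by metis
  note nonneg = diagonalizes_nonneg[OF d(1) assms(1)] diagonalizes_nonneg[OF d(2) assms(2)]
    diagonalizes_nonneg[OF d(3) psd]
  have "0 \<le> (2 * vn_entropy ?\<sigma> - vn_entropy \<rho> - vn_entropy \<rho>') * ln 2"
    by (rule has_integral_nonneg[OF entropy_gap_integral[OF d(1) assms(1) d(2) assms(2) d(3)]])
      (auto intro!: add_nonneg_nonneg mult_nonneg_nonneg chi_sum_nonneg nonneg)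
  thus ?thesis by (simp add: zero_le_mult_iff)
qed

subsection \<open>Partial traces\<close>

text \<open>\<open>\<iota>\<close> models \<open>X \<otimes> 1\<close>, and \<open>E\<close> is its
  dual under the trace pairing. Tracing out \<open>A\<close> and tracing out \<open>B\<close> are
  both instances.\<close>

locale partial_trace =
  fixes \<iota> :: "complex^'m^'m \<Rightarrow> complex^'n^'n" and E :: "complex^'n^'n \<Rightarrow> complex^'m^'m"
  assumes emb_mult: "\<iota> (X ** Y) = \<iota> X ** \<iota> Y"
    and emb_adjoint: "\<iota> (adjoint_mat X) = adjoint_mat (\<iota> X)"
    and trace_emb: "trace (\<iota> X ** R) = trace (X ** E R)"
begin

lemma reduce_add: "E (A + B) = E A + E B"
  by (rule trace_mult_eqI) (simp add: trace_emb[symmetric] matrix_add_ldistrib trace_add)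

lemma reduce_scaleR: "E (r *\<^sub>R A) = r *\<^sub>R E A"
  by (rule trace_mult_eqI)
    (simp add: trace_emb[symmetric] scaleR_matrix_mult_right trace_scaleR)

lemma reduce_diff: "E (A - B) = E A - E B"
  by (rule trace_mult_eqI) (simp add: trace_emb[symmetric] matrix_diff_ldistrib trace_sub)

text \<open>By cyclicity of the trace, embedded factors on either side can be moved over to the test
  matrix \<open>Y\<close> and back.\<close>

lemma reduce_sandwich: "E (\<iota> X ** R ** \<iota> Z) = X ** E R ** Z"
proof (rule trace_mult_eqI)
  fix Y
  have "trace (Y ** E (\<iota> X ** R ** \<iota> Z)) = trace (\<iota> (Y ** X) ** R ** \<iota> Z)"
    by (simp add: trace_emb[symmetric] emb_mult matrix_mul_assoc)
  also have "\<dots> = trace (\<iota> (Z ** (Y ** X)) ** R)"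
    by (subst trace_mul_sym) (simp add: emb_mult matrix_mul_assoc)
  also have "\<dots> = trace (Z ** (Y ** X ** E R))"
    by (simp add: trace_emb matrix_mul_assoc)
  also have "\<dots> = trace (Y ** (X ** E R ** Z))"
    by (subst trace_mul_sym) (simp add: matrix_mul_assoc)
  finally show "trace (Y ** E (\<iota> X ** R ** \<iota> Z)) = \<dots>" .
qed

text \<open>Each term of \<open>chi_var\<close> is a trace of a state multiplied by embedded
  matrices, so only the reduced states enter.\<close>

lemma chi_var_emb: "chi_var u \<rho> \<sigma> (\<iota> Y) = chi_var u (E \<rho>) (E \<sigma>) Y"
proof -
  have *: "trace (\<iota> X ** R ** \<iota> Z) = trace (X ** E R ** Z)" for X R Z
    by (metis trace_mul_sym matrix_mul_assoc emb_mult trace_emb)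
  show ?thesis
    by (simp add: chi_var_def trace_emb reduce_diff * flip: emb_adjoint)
qed

lemma reduce_psd:
  assumes "psd R"
  shows "psd (E R)"
  unfolding psd_def
proof (intro conjI allI)
  have "trace (Y ** adjoint_mat (E R)) = trace (Y ** E R)" for Y
  proof -
    have c: "trace (adjoint_mat A) = cnj (trace A)" for A :: "complex^'k^'k"
      by (simp add: trace_def adjoint_mat_def)
    have "trace (Y ** adjoint_mat (E R)) = cnj (trace (E R ** adjoint_mat Y))"
      by (simp add: adjoint_mult flip: c)
    also have "\<dots> = cnj (trace (R ** adjoint_mat (\<iota> Y)))"
      by (metis trace_mul_sym trace_emb emb_adjoint)
    also have "\<dots> = trace (\<iota> Y ** R)"
      using assms by (simp add: adjoint_mult psd_def hermitian_def flip: c)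
    finally show ?thesis by (simp add: trace_emb)
  qed
  thus "hermitian (E R)" unfolding hermitian_def by (rule trace_mult_eqI)
  fix v
  \<comment> \<open>One column of \<open>W\<close>, at the arbitrary index \<open>undefined\<close>,
    is \<open>v\<close>, and the others are 0; a quadratic form thereby becomes a trace, to which
    duality applies.\<close>
  define W :: "complex^'m^'m" where "W = outer v (axis undefined 1)"
  have W: "W $ i $ j = (if j = undefined then v $ i else 0)" for i j
    by (simp add: W_def outer_def axis_def)
  have "(E R ** W) $ i $ j = (if j = undefined then (E R *v v) $ i else 0)" for i j
    by (simp add: matrix_matrix_mult_def matrix_vector_mult_def W)
  hence "cinner v (E R *v v) = trace (adjoint_mat W ** E R ** W)"
    by (simp add: matrix_mul_assoc[symmetric] trace_adjoint_mult W cinner_def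
        if_distrib[of cnj] if_distrib[of "\<lambda>x. x * _"] if_distrib[of "\<lambda>x. _ * x"] cong: if_cong)
  also have "\<dots> = trace (adjoint_mat (\<iota> W) ** R ** \<iota> W)"
    by (metis trace_mul_sym matrix_mul_assoc emb_mult trace_emb emb_adjoint)
  finally show "0 \<le> Re (cinner v (E R *v v))"
    using psd_trace[OF psd_congruence[OF assms]] by simp
qed

text \<open>If \<open>Y\<close> is optimal for the reduced states, then \<open>\<iota> Y\<close> is
  a competitor with the same value for the full states.\<close>

lemma chi_sum_reduce:
  assumes \<rho>: "diagonalizes U p \<rho>" "psd \<rho>" and \<sigma>: "diagonalizes V q \<sigma>" "psd \<sigma>"
    and "diagonalizes U' p' (E \<rho>)" "diagonalizes V' q' (E \<sigma>)"
    and u: "0 < u" "u < 1"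
  shows "chi_sum u U' p' V' q' \<le> chi_sum u U p V q"
  using chi_sum_attained[OF assms(5,6)] chi_var_le_chi_sum[OF \<rho> \<sigma> u] by (metis chi_var_emb)

text \<open>Integrating \<open>chi_sum_reduce\<close> for both states gives monotonicity of the sum
  of their relative entropies to the midpoint.\<close>

theorem entropy_gap_reduce:
  assumes "psd \<rho>" "psd \<rho>'"
  shows "2 * vn_entropy (E ((1/2) *\<^sub>R (\<rho> + \<rho>'))) - vn_entropy (E \<rho>) - vn_entropy (E \<rho>')
    \<le> 2 * vn_entropy ((1/2) *\<^sub>R (\<rho> + \<rho>')) - vn_entropy \<rho> - vn_entropy \<rho>'"
proof -
  let ?\<sigma> = "(1/2) *\<^sub>R (\<rho> + \<rho>')"
  have psd: "psd ?\<sigma>" using assms by (intro psd_scaleR psd_add) auto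
  obtain U p U' p' V q where d: "diagonalizes U p \<rho>" "diagonalizes U' p' \<rho>'" "diagonalizes V q ?\<sigma>"
    using assms psd psd_diagonalizes by metis
  obtain W r W' r' X s where e: "diagonalizes W r (E \<rho>)" "diagonalizes W' r' (E \<rho>')"
    "diagonalizes X s (E ?\<sigma>)"
    using assms psd psd_diagonalizes reduce_psd by metis
  have E: "E ?\<sigma> = (1/2) *\<^sub>R (E \<rho> + E \<rho>')" by (simp add: reduce_scaleR reduce_add)
  have "(2 * vn_entropy (E ?\<sigma>) - vn_entropy (E \<rho>) - vn_entropy (E \<rho>')) * ln 2
    \<le> (2 * vn_entropy ?\<sigma> - vn_entropy \<rho> - vn_entropy \<rho>') * ln 2"
    unfolding E
    by (rule has_integral_le[OF
          entropy_gap_integral[OF e(1) reduce_psd[OF assms(1)] e(2) reduce_psd[OF assms(2)] e(3)[unfolded E]]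
          entropy_gap_integral[OF d(1) assms(1) d(2) assms(2) d(3)]])
      (auto intro!: add_mono mult_left_mono chi_sum_reduce[OF d(1) assms(1) d(3) psd e(1,3)]
        chi_sum_reduce[OF d(2) assms(2) d(3) psd e(2,3)])
  thus ?thesis by simp
qed

end

text \<open>\<open>h\<close>, with coordinates \<open>f\<close> and \<open>g\<close>, identifies
  \<open>'n\<close> with a product whose second factor is traced out. This covers \<open>A\<close>,
  which sits between \<open>T\<close> and \<open>B\<close>, as well as \<open>B\<close>.\<close>

lemma partial_trace_product:
  fixes h :: "'m::finite \<Rightarrow> 'k::finite \<Rightarrow> 'n::finite"
  assumes h: "\<And>n. h (f n) (g n) = n" "\<And>x y. f (h x y) = x" "\<And>x y. g (h x y) = y"
  shows "partial_trace (\<lambda>X. \<chi> i j. if g i = g j then X $ f i $ f j else 0)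
    (\<lambda>R. \<chi> i j. \<Sum>y\<in>UNIV. R $ h i y $ h j y)"
proof
  have sum_h: "(\<Sum>n\<in>UNIV. s n) = (\<Sum>x\<in>UNIV. \<Sum>y\<in>UNIV. s (h x y))" for s :: "'n \<Rightarrow> complex"
    unfolding sum.cartesian_product
    by (rule sum.reindex_bij_witness[of _ "\<lambda>(x, y). h x y" "\<lambda>n. (f n, g n)"]) (auto simp: h)
  fix X Y :: "complex^'m^'m" and R :: "complex^'n^'n"
  let ?emb = "\<lambda>X::complex^'m^'m. (\<chi> i j. if g i = g j then X $ f i $ f j else 0) :: complex^'n^'n"
  show "?emb (X ** Y) = ?emb X ** ?emb Y"
    by (simp add: vec_eq_iff matrix_matrix_mult_def sum_h h if_distrib[of "\<lambda>x. x * _"]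
        if_distrib[of "\<lambda>x. _ * x"] cong: if_cong)
  show "?emb (adjoint_mat X) = adjoint_mat (?emb X)"
    by (simp add: vec_eq_iff adjoint_mat_def)
  have "trace (?emb X ** R)
      = (\<Sum>x\<in>UNIV. \<Sum>y\<in>UNIV. \<Sum>x'\<in>UNIV. X $ x $ x' * R $ h x' y $ h x y)"
    by (simp add: trace_def matrix_matrix_mult_def sum_h h if_distrib[of "\<lambda>x. x * _"] cong: if_cong)
  also have "\<dots> = (\<Sum>x\<in>UNIV. \<Sum>x'\<in>UNIV. \<Sum>y\<in>UNIV. X $ x $ x' * R $ h x' y $ h x y)"
    by (intro sum.cong refl sum.swap)
  also have "\<dots> = trace (X ** (\<chi> i j. \<Sum>y\<in>UNIV. R $ h i y $ h j y))"
    by (simp add: trace_def matrix_matrix_mult_def sum_distrib_left)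
  finally show "trace (?emb X ** R) = \<dots>" .
qed

definition emb_TA ::
    "complex^(2 \<times> 'a::finite)^(2 \<times> 'a) \<Rightarrow> complex^(2 \<times> 'a \<times> 'b::finite)^(2 \<times> 'a \<times> 'b)" where
  "emb_TA X = (\<chi> i j. if snd (snd i) = snd (snd j)
     then X $ (fst i, fst (snd i)) $ (fst j, fst (snd j)) else 0)"

definition emb_TB ::
    "complex^(2 \<times> 'b::finite)^(2 \<times> 'b) \<Rightarrow> complex^(2 \<times> 'a::finite \<times> 'b)^(2 \<times> 'a \<times> 'b)" where
  "emb_TB X = (\<chi> i j. if fst (snd i) = fst (snd j)
     then X $ (fst i, snd (snd i)) $ (fst j, snd (snd j)) else 0)"

lemma partial_trace_TA: "partial_trace emb_TA reduce_TA"
  using partial_trace_product[of "\<lambda>x y. (fst x, snd x, y)" "\<lambda>n. (fst n, fst (snd n))"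
      "\<lambda>n. snd (snd n)"]
  by (simp add: emb_TA_def[abs_def] reduce_TA_def[abs_def])

lemma partial_trace_TB: "partial_trace emb_TB reduce_TB"
  using partial_trace_product[of "\<lambda>x y. (fst x, y, snd x)" "\<lambda>n. (fst n, snd (snd n))"
      "\<lambda>n. fst (snd n)"]
  by (simp add: emb_TB_def[abs_def] reduce_TB_def[abs_def])

text \<open>Needed so that an operation on \<open>T\<close> commutes with tracing out
  \<open>B\<close>.\<close>

lemma emb_TA_tensor: "emb_TA (tensor \<sigma> (mat 1)) = tensor \<sigma> (mat 1)"
  by (auto simp: emb_TA_def tensor_def mat_def vec_eq_iff)

lemma emb_TB_tensor: "emb_TB (tensor \<sigma> (mat 1)) = tensor \<sigma> (mat 1)"
  by (auto simp: emb_TB_def tensor_def mat_def vec_eq_iff)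

subsection \<open>One-bit channels\<close>

lemma tensor_mult: "tensor A B ** tensor C D = tensor (A ** C) (B ** D)"
  by (simp add: vec_eq_iff tensor_def matrix_matrix_mult_def sum_product UNIV_Times_UNIV[symmetric]
      sum.cartesian_product case_prod_beta mult_ac del: UNIV_Times_UNIV)

lemma tensor_one: "tensor (mat 1) (mat 1) = mat 1"
  by (auto simp: vec_eq_iff tensor_def mat_def prod_eq_iff)

lemma adjoint_tensor: "adjoint_mat (tensor A B) = tensor (adjoint_mat A) (adjoint_mat B)"
  by (simp add: vec_eq_iff tensor_def adjoint_mat_def)

lemma adjoint_mat_one: "adjoint_mat (mat 1) = mat 1"
  by (auto simp: vec_eq_iff mat_def adjoint_mat_def)

definition hermitian_unitary :: "complex^'n^'n \<Rightarrow> bool" where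
  "hermitian_unitary \<sigma> \<longleftrightarrow> hermitian \<sigma> \<and> \<sigma> ** \<sigma> = mat 1"

lemma hermitian_unitary_tensor:
  "hermitian_unitary \<sigma> \<Longrightarrow> hermitian_unitary (tensor \<sigma> (mat 1))"
  by (simp add: hermitian_unitary_def hermitian_def tensor_mult tensor_one adjoint_tensor
      adjoint_mat_one)

lemma psd_conj_T:
  fixes R :: "complex^(2 \<times> 's::finite)^(2 \<times> 's)"
  assumes "hermitian_unitary \<sigma>" "psd R"
  shows "psd (conj_T \<sigma> R)"
proof -
  have "hermitian_unitary (tensor \<sigma> (mat 1) :: complex^(2 \<times> 's)^(2 \<times> 's))"
    by (rule hermitian_unitary_tensor[OF assms(1)])
  hence "adjoint_mat (tensor \<sigma> (mat 1)) = (tensor \<sigma> (mat 1) :: complex^(2 \<times> 's)^(2 \<times> 's))"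
    by (simp add: hermitian_unitary_def hermitian_def)
  thus ?thesis using psd_congruence[OF assms(2)] unfolding conj_T_def by metis
qed

lemma psd_Phi_one: "hermitian_unitary \<sigma> \<Longrightarrow> psd R \<Longrightarrow> psd (Phi_one \<sigma> R)"
  unfolding Phi_one_def by (intro psd_scaleR psd_add psd_conj_T) auto

text \<open>Conjugation rotates the eigenvectors and keeps the eigenvalues.\<close>

lemma vn_entropy_conj_T:
  fixes R :: "complex^(2 \<times> 's::finite)^(2 \<times> 's)"
  assumes \<sigma>: "hermitian_unitary \<sigma>" and R: "psd R"
  shows "vn_entropy (conj_T \<sigma> R) = vn_entropy R"
proof -
  define S :: "complex^(2 \<times> 's)^(2 \<times> 's)" where "S = tensor \<sigma> (mat 1)"
  have S: "adjoint_mat S = S" "S ** S = mat 1"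
    using hermitian_unitary_tensor[OF \<sigma>] by (auto simp: S_def hermitian_unitary_def hermitian_def)
  obtain U d where U: "diagonalizes U d R" using psd_diagonalizes[OF R] by blast
  have "unitary (S ** U)"
    using U S unfolding diagonalizes_def unitary_def adjoint_mult
    by (metis matrix_mul_assoc matrix_mul_rid)
  hence "diagonalizes (S ** U) d (conj_T \<sigma> R)"
    using U S by (simp add: diagonalizes_def conj_T_def S_def[symmetric] adjoint_mult matrix_mul_assoc)
  hence "vn_entropy (conj_T \<sigma> R) * ln 2 = vn_entropy R * ln 2"
    using vn_entropy_diagonalizes U by metis
  thus ?thesis by simp
qed

lemma Phi_one_entropy_mono:
  assumes "hermitian_unitary \<sigma>" "psd R"
  shows "vn_entropy R \<le> vn_entropy (Phi_one \<sigma> R)"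
  using vn_entropy_midpoint_concave[OF assms(2) psd_conj_T[OF assms]] vn_entropy_conj_T[OF assms]
  by (simp add: Phi_one_def)

context
  fixes \<iota> :: "complex^(2 \<times> 'r::finite)^(2 \<times> 'r) \<Rightarrow> complex^(2 \<times> 's::finite)^(2 \<times> 's)" and E and \<sigma>
  assumes pt: "partial_trace \<iota> E" and \<iota>: "\<iota> (tensor \<sigma> (mat 1)) = tensor \<sigma> (mat 1)"
begin

interpretation partial_trace \<iota> E by (rule pt)

lemma reduce_conj_T: "E (conj_T \<sigma> R) = conj_T \<sigma> (E R)"
  by (metis conj_T_def \<iota> reduce_sandwich)

lemma reduce_Phi_one: "E (Phi_one \<sigma> R) = Phi_one \<sigma> (E R)"
  by (simp add: Phi_one_def reduce_scaleR reduce_add reduce_conj_T)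

text \<open>The two states averaged by the channel have equal entropy, before and after reduction,
  so the gap in \<open>entropy_gap_reduce\<close> is twice the one-bit gain.\<close>

lemma Phi_one_entropy_reduce:
  assumes \<sigma>: "hermitian_unitary \<sigma>" and R: "psd R"
  shows "vn_entropy (Phi_one \<sigma> (E R)) - vn_entropy (E R) \<le> vn_entropy (Phi_one \<sigma> R) - vn_entropy R"
  using entropy_gap_reduce[OF R psd_conj_T[OF \<sigma> R]] vn_entropy_conj_T[OF \<sigma> R]
    vn_entropy_conj_T[OF \<sigma> reduce_psd[OF R]]
  unfolding Phi_one_def[symmetric] reduce_conj_T reduce_Phi_one by simp

end

lemma conj_T_add: "conj_T \<sigma> (A + B) = conj_T \<sigma> A + conj_T \<sigma> B"
  by (simp add: conj_T_def matrix_add_ldistrib matrix_add_rdistrib)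

lemma conj_T_scaleR: "conj_T \<sigma> (r *\<^sub>R A) = r *\<^sub>R conj_T \<sigma> A"
  by (simp add: conj_T_def scaleR_matrix_mult_left scaleR_matrix_mult_right)

lemma conj_T_conj_T:
  fixes R :: "complex^(2 \<times> 's::finite)^(2 \<times> 's)"
  shows "conj_T \<sigma> (conj_T \<tau> R) = tensor (\<sigma> ** \<tau>) (mat 1) ** R ** tensor (\<tau> ** \<sigma>) (mat 1)"
proof -
  have "tensor (\<sigma> ** \<tau>) (mat 1) = tensor \<sigma> (mat 1) ** tensor \<tau> (mat 1 :: complex^'s^'s)"
    for \<sigma> \<tau> :: "complex^2^2"
    by (simp add: tensor_mult)
  thus ?thesis by (simp add: conj_T_def matrix_mul_assoc)
qed

subsection \<open>Pauli matrices\<close>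

lemma outer_mult: "(outer a b ** outer c d) $ i $ j = cinner b c * outer a d $ i $ j"
  by (simp add: outer_def matrix_matrix_mult_def cinner_def sum_distrib_left sum_distrib_right mult_ac)

context
  fixes e0 e1 :: "complex^2"
  assumes on: "cinner e0 e0 = 1" "cinner e1 e1 = 1" "cinner e0 e1 = 0"
begin

lemma cinner_swap: "cinner e1 e0 = 0"
  using on(3) cnj_cinner[of e0 e1] by simp

text \<open>A square matrix with orthonormal columns has a left inverse, which is also a right
  inverse.\<close>

lemma outer_completeness: "outer e0 e0 + outer e1 e1 = mat 1"
proof -
  define V :: "complex^2^2" where "V = (\<chi> i j. if j = 1 then e0 $ i else e1 $ i)"
  have "adjoint_mat V ** V = mat 1"
    using on cinner_swap
    by (simp add: vec_eq_iff forall_2 V_def matrix_matrix_mult_def adjoint_mat_def mat_def cinner_def)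
  hence "V ** adjoint_mat V = mat 1" using matrix_left_right_inverse by blast
  moreover have "V ** adjoint_mat V = outer e0 e0 + outer e1 e1"
    by (simp add: vec_eq_iff V_def matrix_matrix_mult_def adjoint_mat_def outer_def sum_2)
  ultimately show ?thesis by simp
qed

lemma hermitian_unitary_pauli_x: "hermitian_unitary (pauli_x e0 e1)"
proof -
  have "pauli_x e0 e1 ** pauli_x e0 e1 = outer e0 e0 + outer e1 e1"
    using on cinner_swap
    by (simp add: vec_eq_iff pauli_x_def matrix_add_ldistrib matrix_add_rdistrib outer_mult)
  thus ?thesis unfolding outer_completeness
    by (simp add: hermitian_unitary_def hermitian_def pauli_x_def vec_eq_iff adjoint_mat_def
        outer_def mult.commute)
qed

lemma hermitian_unitary_pauli_z: "hermitian_unitary (pauli_z e0 e1)"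
proof -
  have "pauli_z e0 e1 ** pauli_z e0 e1 = outer e0 e0 + outer e1 e1"
    using on cinner_swap
    by (simp add: vec_eq_iff pauli_z_def matrix_diff_ldistrib matrix_diff_rdistrib outer_mult)
  thus ?thesis unfolding outer_completeness
    by (simp add: hermitian_unitary_def hermitian_def pauli_z_def vec_eq_iff adjoint_mat_def
        outer_def mult.commute)
qed

text \<open>The product of x and z is y up to a phase, and the phases on the two sides
  cancel.\<close>

lemma conj_T_pauli_xz:
  "conj_T (pauli_x e0 e1) (conj_T (pauli_z e0 e1) R) = conj_T (pauli_y e0 e1) R"
proof -
  define W where "W = outer e1 e0 - outer e0 e1"
  have xz: "pauli_x e0 e1 ** pauli_z e0 e1 = W" and zx: "pauli_z e0 e1 ** pauli_x e0 e1 = - W"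
    using on cinner_swap
    by (simp_all add: vec_eq_iff pauli_x_def pauli_z_def W_def matrix_add_ldistrib
        matrix_add_rdistrib matrix_diff_ldistrib matrix_diff_rdistrib outer_mult)
  have y: "pauli_y e0 e1 $ i $ j = \<i> * W $ i $ j" for i j
    by (simp add: pauli_y_def W_def outer_def algebra_simps)
  show ?thesis
    unfolding conj_T_conj_T xz zx
    by (simp add: vec_eq_iff conj_T_def y tensor_def matrix_matrix_mult_def sum_distrib_left
        sum_distrib_right algebra_simps sum_negf)
qed

lemma Phi_C_eq: "Phi_C e0 e1 R = Phi_one (pauli_x e0 e1) (Phi_one (pauli_z e0 e1) R)"
proof -
  have "conj_T (mat 1) R = R" by (simp add: conj_T_def tensor_one)
  thus ?thesis
    by (simp add: Phi_C_def Phi_one_def conj_T_scaleR conj_T_add conj_T_pauli_xz scaleR_add_right)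
qed

end

subsection \<open>The C-PID elements\<close>

text \<open>Here \<open>a\<close> and \<open>b\<close> are the parallel capacities,
  \<open>A\<close>, \<open>B\<close> and \<open>AB\<close> the two-bit ones, and \<open>q\<close> is
  the difference of the transverse capacities, which may be any real number.\<close>

lemma cpid_nonneg_arith:
  fixes a b A B AB q :: real
  assumes "0 \<le> a" "0 \<le> b" "a \<le> A" "b \<le> B" "A \<le> AB" "B \<le> AB" "a + (B - b) \<le> AB" "b + (A - a) \<le> AB"
    and \<Gamma>\<^sub>A: "\<Gamma>\<^sub>A = max (a - b) 0 + max q 0" and \<Gamma>\<^sub>B: "\<Gamma>\<^sub>B = max (b - a) 0 + max (- q) 0"
    and \<gamma>\<^sub>A: "\<gamma>\<^sub>A = \<Gamma>\<^sub>A + min ((A - B) - (\<Gamma>\<^sub>A - \<Gamma>\<^sub>B)) 0"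
    and \<gamma>\<^sub>B: "\<gamma>\<^sub>B = \<Gamma>\<^sub>B + min (- ((A - B) - (\<Gamma>\<^sub>A - \<Gamma>\<^sub>B))) 0"
  shows "\<bar>\<gamma>\<^sub>A\<bar> + \<bar>\<gamma>\<^sub>B\<bar> \<le> A + B" "A + B + \<bar>\<gamma>\<^sub>A\<bar> + \<bar>\<gamma>\<^sub>B\<bar> \<le> 2 * AB"
proof -
  \<comment> \<open>If the parallel and transverse differences favour the same system, the other
    system's term is 0; if they favour opposite systems, each term is a single difference.\<close>
  have \<Gamma>: "\<Gamma>\<^sub>A \<ge> 0" "\<Gamma>\<^sub>B \<ge> 0" "\<Gamma>\<^sub>A = 0 \<or> \<Gamma>\<^sub>B = 0 \<or> \<Gamma>\<^sub>A = a - b \<or> \<Gamma>\<^sub>B = b - a"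
    unfolding \<Gamma>\<^sub>A \<Gamma>\<^sub>B by (auto simp: max_def)
  have diff: "\<gamma>\<^sub>A - \<gamma>\<^sub>B = A - B" unfolding \<gamma>\<^sub>A \<gamma>\<^sub>B by (auto simp: min_def)
  have sum: "\<gamma>\<^sub>A + \<gamma>\<^sub>B \<le> 2 * \<Gamma>\<^sub>A + B - A" "\<gamma>\<^sub>A + \<gamma>\<^sub>B \<le> 2 * \<Gamma>\<^sub>B + A - B" "\<gamma>\<^sub>A + \<gamma>\<^sub>B \<ge> - \<bar>A - B\<bar>"
    using \<Gamma>(1,2) unfolding \<gamma>\<^sub>A \<gamma>\<^sub>B by (auto simp: min_def)
  have abs: "\<bar>\<gamma>\<^sub>A\<bar> + \<bar>\<gamma>\<^sub>B\<bar> = max \<bar>\<gamma>\<^sub>A + \<gamma>\<^sub>B\<bar> \<bar>A - B\<bar>"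
    unfolding diff[symmetric] by (auto simp: max_def abs_if)
  \<comment> \<open>When a \<open>\<Gamma>\<close> is 0, the bounds on \<open>A\<close> and
    \<open>B\<close> suffice; when it is a parallel difference, \<open>sum\<close> turns the second
    claim into a mixed-sum hypothesis.\<close>
  have "\<gamma>\<^sub>A + \<gamma>\<^sub>B \<le> A + B" "A + B + (\<gamma>\<^sub>A + \<gamma>\<^sub>B) \<le> 2 * AB"
    using sum(1,2) \<Gamma>(3) assms(1-8) by auto
  thus "\<bar>\<gamma>\<^sub>A\<bar> + \<bar>\<gamma>\<^sub>B\<bar> \<le> A + B" "A + B + \<bar>\<gamma>\<^sub>A\<bar> + \<bar>\<gamma>\<^sub>B\<bar> \<le> 2 * AB"
    unfolding add.assoc abs using sum(3) assms(1-8) by (auto simp: max_def)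
qed

theorem theorem1:
  fixes R :: "complex^(2 \<times> 'a::finite \<times> 'b::finite)^(2 \<times> 'a \<times> 'b)"
    and e0 e1 :: "complex^2"
  assumes "CARD('a) \<ge> 2"
    and "CARD('b) \<ge> 2"
    and "density_operator R"
    and "orthonormal_eigenbasis (reduce_T R) e0 e1"
  shows "C_unqA e0 e1 R \<ge> 0 \<and> C_unqB e0 e1 R \<ge> 0 \<and> C_red e0 e1 R \<ge> 0 \<and> C_syn e0 e1 R \<ge> 0"
proof -
  have R: "psd R" using assms(3) by (simp add: density_operator_def psd_def)
  have on: "cinner e0 e0 = 1" "cinner e1 e1 = 1" "cinner e0 e1 = 0"
    using assms(4) by (auto simp: orthonormal_eigenbasis_def)
  note x = hermitian_unitary_pauli_x[OF on] and z = hermitian_unitary_pauli_z[OF on]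
  let ?x = "pauli_x e0 e1" and ?z = "pauli_z e0 e1"
  have R': "psd (Phi_one ?z R)" by (rule psd_Phi_one[OF z R])
  have RA: "psd (reduce_TA R)" and RB: "psd (reduce_TB R)"
    using partial_trace.reduce_psd[OF _ R] partial_trace_TA partial_trace_TB by blast+
  note A = partial_trace_TA emb_TA_tensor and B = partial_trace_TB emb_TB_tensor
  \<comment> \<open>The x-channel is applied to the already dephased state, as in
    \<open>Phi_C_eq\<close>; its reductions are the dephased reduced states.\<close>
  note zA = Phi_one_entropy_reduce[OF A z R] and zB = Phi_one_entropy_reduce[OF B z R]
    and xA = Phi_one_entropy_reduce[OF A x R', unfolded reduce_Phi_one[OF A]]
    and xB = Phi_one_entropy_reduce[OF B x R', unfolded reduce_Phi_one[OF B]]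
    and nonneg = Phi_one_entropy_mono[OF z RA] Phi_one_entropy_mono[OF z RB]
      Phi_one_entropy_mono[OF x psd_Phi_one[OF z RA]] Phi_one_entropy_mono[OF x psd_Phi_one[OF z RB]]
  let ?a = "cap_par e0 e1 (reduce_TA R)" and ?b = "cap_par e0 e1 (reduce_TB R)"
  \<comment> \<open>Both gains shrink under reduction, so the z-gain of one subsystem and the x-gain
    of the other still add up to at most \<open>C_AB\<close>.\<close>
  have ineqs: "0 \<le> ?a" "0 \<le> ?b" "?a \<le> C_A e0 e1 R" "?b \<le> C_B e0 e1 R"
    "C_A e0 e1 R \<le> C_AB e0 e1 R" "C_B e0 e1 R \<le> C_AB e0 e1 R"
    "?a + (C_B e0 e1 R - ?b) \<le> C_AB e0 e1 R" "?b + (C_A e0 e1 R - ?a) \<le> C_AB e0 e1 R"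
    unfolding cap_def cap_par_def C_A_def C_B_def C_AB_def Phi_C_eq[OF on]
    using nonneg xA zA xB zB by linarith+
  have "Gamma_A e0 e1 R = max (?a - ?b) 0
      + max (cap_perp e0 e1 (reduce_TA R) - cap_perp e0 e1 (reduce_TB R)) 0"
    "Gamma_B e0 e1 R = max (?b - ?a) 0
      + max (- (cap_perp e0 e1 (reduce_TA R) - cap_perp e0 e1 (reduce_TB R))) 0"
    by (simp_all add: Gamma_A_def Gamma_B_def unique_one_bit_def)
  note cpid_nonneg_arith[OF ineqs this gamma_A_def[unfolded Delta_A_def]
      gamma_B_def[unfolded Delta_B_def Delta_A_def]]
  thus ?thesis
    by (simp add: C_unqA_def C_unqB_def C_red_def C_syn_def min_le_iff_disj le_max_iff_disj)
qed

end
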